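(* Let $l\ge 0$ be an integer and $1\le p\le\infty$ (with $1/\infty:=0$). There exists a constant $C_{l,d}\ge 1$, depending only on $l$ and $d$, such that for every affine partition $\mathcal{T}_h$, every $T\in\mathcal{T}_h$, and every $w\in W^{l,p}(T)$ with $\hat w:=w\circ F_T$, the following estimates hold: $$|\hat w|_{l,p,\hat T}\le C_{l,d}\,\|J_T\|_{\ell^2}^{l}\,|\det J_T|^{-1/p}\,|w|_{l,p,T},$$ $$|w|_{l,p,T}\le C_{l,d}\,\|J_T^{-1}\|_{\ell^2}^{l}\,|\det J_T|^{1/p}\,|\hat w|_{l,p,\hat T}.$$ In particular, one may take $C_{0,d}=1$.
   Context: $d\in\mathbb{N}$, $\hat T:=[-1,1]^d$. A partition $\mathcal{T}_h$ of a bounded polyhedral Lipschitz domain $\Omega\subset\mathbb{R}^d$ is called affine if each (closed) element $T\in\mathcal{T}_h$ is the image $T=F_T(\hat T)$ of $\hat T$ under an affine map $F_T(\hat x)=J_T\hat x+b_T$ with $J_T\in\mathbb{R}^{d\times d}$, $\det J_T\neq 0$, $b_T\in\mathbb{R}^d$. $\|J\|_{\ell^2}$ denotes the matrix norm induced by the Euclidean norm (spectral norm). For an integer $l\ge0$, $|w|_{l,p,G}:=\big(\sum_{|\alpha|=l}\|\partial^\alpha w\|_{L^p(G)}^p\big)^{1/p}$ for $p<\infty$ and $|w|_{l,\infty,G}:=\max_{|\alpha|=l}\|\partial^\alpha w\|_{L^\infty(G)}$ are the Sobolev seminorms of $W^{l,p}(G)$. *)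

theory Defs
  imports "HOL-Probability.Essential_Supremum"
begin

definition partial_deriv :: "'n::finite \<Rightarrow> (real^'n \<Rightarrow> real) \<Rightarrow> real^'n \<Rightarrow> real" where
  "partial_deriv i f x = frechet_derivative f (at x) (axis i 1)"

primrec iter_partial :: "'n::finite list \<Rightarrow> (real^'n \<Rightarrow> real) \<Rightarrow> real^'n \<Rightarrow> real" where
  "iter_partial [] f = f"
| "iter_partial (i # is) f = partial_deriv i (iter_partial is f)"

text \<open>If every iterated partial derivative is differentiable, then all of them are continuous,
  so this is membership in $C^\infty$.\<close>

definition smooth_fun :: "(real^'n::finite \<Rightarrow> real) \<Rightarrow> bool" where
  "smooth_fun f \<longleftrightarrow> (\<forall>is x. iter_partial is f differentiable (at x))"

text \<open>Multi-indices are functions on the (unordered) index type. The chosen list contains each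
  index \<open>i\<close> exactly \<open>\<alpha> i\<close> times. The operator is only applied to smooth functions, for which the
  order of differentiation is immaterial.\<close>

definition mi_order :: "('n::finite \<Rightarrow> nat) \<Rightarrow> nat" where
  "mi_order \<alpha> = (\<Sum>i\<in>UNIV. \<alpha> i)"

definition mi_partial :: "('n::finite \<Rightarrow> nat) \<Rightarrow> (real^'n \<Rightarrow> real) \<Rightarrow> real^'n \<Rightarrow> real" where
  "mi_partial \<alpha> f = iter_partial (SOME is. \<forall>i. count_list is i = \<alpha> i) f"

lemma finite_mi_order: "finite {\<alpha> :: 'n::finite \<Rightarrow> nat. mi_order \<alpha> = l}"
proof (rule finite_subset)
  show "{\<alpha> :: 'n \<Rightarrow> nat. mi_order \<alpha> = l} \<subseteq> PiE UNIV (\<lambda>_. {..l})"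
    by (auto simp: mi_order_def intro: member_le_sum)
  show "finite (PiE (UNIV :: 'n set) (\<lambda>_. {..l}))"
    by (intro finite_PiE) auto
qed

lemma mi_order_nonempty: "{\<alpha> :: 'n::finite \<Rightarrow> nat. mi_order \<alpha> = l} \<noteq> {}"
proof -
  have "mi_order (\<lambda>i :: 'n. if i = undefined then l else 0) = l"
    by (simp add: mi_order_def)
  then show ?thesis by blast
qed

definition test_funs :: "(real^'n::finite) set \<Rightarrow> (real^'n \<Rightarrow> real) set" where
  "test_funs U = {\<phi>. smooth_fun \<phi> \<and> compact (closure {x. \<phi> x \<noteq> 0}) \<and> closure {x. \<phi> x \<noteq> 0} \<subseteq> U}"

definition locally_integrable_on :: "(real^'n::finite \<Rightarrow> real) \<Rightarrow> (real^'n) set \<Rightarrow> bool" where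
  "locally_integrable_on f U \<longleftrightarrow> (\<forall>K. compact K \<and> K \<subseteq> U \<longrightarrow> f absolutely_integrable_on K)"

definition is_weak_deriv ::
    "(real^'n::finite) set \<Rightarrow> ('n \<Rightarrow> nat) \<Rightarrow> (real^'n \<Rightarrow> real) \<Rightarrow> (real^'n \<Rightarrow> real) \<Rightarrow> bool" where
  "is_weak_deriv U \<alpha> w g \<longleftrightarrow>
     locally_integrable_on w U \<and> locally_integrable_on g U \<and>
     (\<forall>\<phi>\<in>test_funs U.
        (LINT x|lebesgue_on U. w x * mi_partial \<alpha> \<phi> x) =
        (- 1) ^ mi_order \<alpha> * (LINT x|lebesgue_on U. g x * \<phi> x))"

text \<open>On an open set a weak derivative is unique up to null sets, so the choice does not affect
  Lebesgue norms.\<close>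

definition weak_deriv ::
    "(real^'n::finite) set \<Rightarrow> ('n \<Rightarrow> nat) \<Rightarrow> (real^'n \<Rightarrow> real) \<Rightarrow> real^'n \<Rightarrow> real" where
  "weak_deriv U \<alpha> w = (SOME g. is_weak_deriv U \<alpha> w g)"

text \<open>The elements are functions rather than classes modulo null sets; their values outside \<open>U\<close>
  are irrelevant. The real-valued norm is only meaningful on members of the space. In
  \<^typ>\<open>ennreal\<close> the quotient \<open>1 / \<infinity>\<close> is \<open>0\<close>.\<close>

definition Lp_space :: "ennreal \<Rightarrow> (real^'n::finite) set \<Rightarrow> (real^'n \<Rightarrow> real) set" where
  "Lp_space p U = {f \<in> borel_measurable (lebesgue_on U).
     if p = \<infinity> then esssup (lebesgue_on U) (\<lambda>x. ennreal \<bar>f x\<bar>) < \<infinity>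
     else integrable (lebesgue_on U) (\<lambda>x. \<bar>f x\<bar> powr enn2real p)}"

definition Lp_norm :: "ennreal \<Rightarrow> (real^'n::finite) set \<Rightarrow> (real^'n \<Rightarrow> real) \<Rightarrow> real" where
  "Lp_norm p U f =
     (if p = \<infinity> then enn2real (esssup (lebesgue_on U) (\<lambda>x. ennreal \<bar>f x\<bar>))
      else (LINT x|lebesgue_on U. \<bar>f x\<bar> powr enn2real p) powr enn2real (1 / p))"

definition sobolev_space :: "nat \<Rightarrow> ennreal \<Rightarrow> (real^'n::finite) set \<Rightarrow> (real^'n \<Rightarrow> real) set" where
  "sobolev_space l p U = {w \<in> Lp_space p U.
     \<forall>\<alpha>. mi_order \<alpha> \<le> l \<longrightarrow> (\<exists>g\<in>Lp_space p U. is_weak_deriv U \<alpha> w g)}"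

definition sobolev_seminorm ::
    "nat \<Rightarrow> ennreal \<Rightarrow> (real^'n::finite) set \<Rightarrow> (real^'n \<Rightarrow> real) \<Rightarrow> real" where
  "sobolev_seminorm l p U w =
     (if p = \<infinity> then Max ((\<lambda>\<alpha>. Lp_norm \<infinity> U (weak_deriv U \<alpha> w)) ` {\<alpha>. mi_order \<alpha> = l})
      else (\<Sum>\<alpha> | mi_order \<alpha> = l. Lp_norm p U (weak_deriv U \<alpha> w) powr enn2real p)
             powr enn2real (1 / p))"

text \<open>Near each boundary point, \<open>\<Omega>\<close> is the strict epigraph, in some direction \<open>\<nu>\<close>, of a Lipschitz
  function on the hyperplane orthogonal to \<open>\<nu>\<close>.\<close>

definition lipschitz_domain :: "(real^'n::finite) set \<Rightarrow> bool" where
  "lipschitz_domain \<Omega> \<longleftrightarrow> open \<Omega> \<and> connected \<Omega> \<and> \<Omega> \<noteq> {} \<and>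
     (\<forall>x\<in>frontier \<Omega>. \<exists>N \<nu> L \<gamma>. open N \<and> x \<in> N \<and> norm \<nu> = 1 \<and>
        lipschitz_on L {z. \<nu> \<bullet> z = 0} \<gamma> \<and>
        \<Omega> \<inter> N = {y \<in> N. \<gamma> (y - (\<nu> \<bullet> y) *\<^sub>R \<nu>) < \<nu> \<bullet> y})"

definition polyhedral_domain :: "(real^'n::finite) set \<Rightarrow> bool" where
  "polyhedral_domain \<Omega> \<longleftrightarrow> bounded \<Omega> \<and> lipschitz_domain \<Omega> \<and>
     (\<exists>P. finite P \<and> (\<forall>K\<in>P. polytope K) \<and> closure \<Omega> = \<Union>P)"

definition partition_of :: "(real^'n::finite) set set \<Rightarrow> (real^'n) set \<Rightarrow> bool" where
  "partition_of \<T> \<Omega> \<longleftrightarrow> finite \<T> \<and> (\<forall>T\<in>\<T>. closed T) \<and> \<Union>\<T> = closure \<Omega> \<and>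
     (\<forall>S\<in>\<T>. \<forall>T\<in>\<T>. S \<noteq> T \<longrightarrow> interior S \<inter> interior T = {})"

abbreviation ref_cube :: "(real^'n::finite) set" where
  "ref_cube \<equiv> cbox (- 1) 1"

definition aff_map :: "real^'n^'n \<Rightarrow> real^'n \<Rightarrow> real^'n \<Rightarrow> real^'n::finite" where
  "aff_map A c x = A *v x + c"

text \<open>The families \<open>J\<close> and \<open>b\<close> assign to each element the data of its element map.\<close>

definition affine_partition ::
    "(real^'n::finite) set \<Rightarrow> (real^'n) set set \<Rightarrow>
     ((real^'n) set \<Rightarrow> real^'n^'n) \<Rightarrow> ((real^'n) set \<Rightarrow> real^'n) \<Rightarrow> bool" where
  "affine_partition \<Omega> \<T> J b \<longleftrightarrow> polyhedral_domain \<Omega> \<and> partition_of \<T> \<Omega> \<and>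
     (\<forall>T\<in>\<T>. det (J T) \<noteq> 0 \<and> T = aff_map (J T) (b T) ` ref_cube)"

definition spectral_norm :: "real^'n::finite^'n \<Rightarrow> real" where
  "spectral_norm A = onorm (\<lambda>x. A *v x)"

end

(* With F x = A x + c, weak derivatives of w o F are obtained by duality from the chain rule
   for test functions: if phi = psi o F, then the partial derivative of phi along a list js is the
   sum over all lists "is" of the same length of (prod_m A_{is_m, js_m}) (d^is psi) o F, and the
   substitution y = F x turns this into the same expansion of the weak derivatives of w o F with
   coefficients of modulus at most |A|^l. The crude bound (sum of N terms)^p <= N^p sum of p-th
   powers gives the constant M N^2, with N = d^l lists and M multi-indices of order l; it is 1
   for l = 0. The seminorms refer to an arbitrarily chosen weak derivative, so uniqueness almost
   everywhere is needed: smooth bumps approximate indicators of boxes, and an integrable function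
   whose integral over every box vanishes is zero almost everywhere. The second estimate is the
   first one for the inverse map. *)

theory Submission
  imports Defs
begin

section \<open>Smooth functions\<close>

text \<open>Weak derivatives are indexed by multi-indices, but grouping the chain rule by
  multi-index would bring in multinomial counts. Lists avoid them: one more derivative prepends one
  index and one matrix entry. The price is that \<open>mi_partial\<close> differentiates along a
  list picked by \<open>SOME\<close>, so partial derivatives of smooth functions must be shown to
  commute before another list can be used in the weak formulation. A second obstacle is that Bochner
  integrals are total: splitting the integral of a sum needs integrability, which local
  integrability only gives against a compactly supported factor. Finally, the estimate for the
  inverse map takes w o F as its input, so the transfer result has to deliver Sobolev membership of
  the composition along with the bound, and it is stated for an arbitrary open set and its preimage
  rather than for the cube.\<close>

lemma partial_derivI:
  assumes "(f has_derivative f') (at x)"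
  shows "partial_deriv i f x = f' (axis i 1)"
  using frechet_derivative_at[OF assms] by (simp add: partial_deriv_def)

lemma smooth_fun_differentiable: "smooth_fun f \<Longrightarrow> f differentiable (at x)"
  unfolding smooth_fun_def by (metis iter_partial.simps(1))

lemma iter_partial_append: "iter_partial (is @ js) f = iter_partial is (iter_partial js f)"
  by (induction "is") auto

lemma smooth_fun_iter_partial: "smooth_fun f \<Longrightarrow> smooth_fun (iter_partial js f)"
  unfolding smooth_fun_def iter_partial_append[symmetric] by blast

lemma smooth_fun_partial_deriv: "smooth_fun f \<Longrightarrow> smooth_fun (partial_deriv i f)"
  using smooth_fun_iter_partial[of f "[i]"] by simp

lemma smooth_fun_continuous_on: "smooth_fun f \<Longrightarrow> continuous_on S f"
  by (meson continuous_at_imp_continuous_on differentiable_imp_continuous_within smooth_fun_differentiable)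

text \<open>Proves smoothness for a whole class of functions at once, with no formula for higher
  derivatives; \<open>bump_algebra\<close> is the class it is meant for.\<close>

lemma smooth_fun_coinduct [consumes 1, case_names differentiable closed]:
  assumes "f \<in> S"
    and diff: "\<And>g x. g \<in> S \<Longrightarrow> g differentiable (at x)"
    and closed: "\<And>g i. g \<in> S \<Longrightarrow> partial_deriv i g \<in> S"
  shows "smooth_fun f"
proof -
  have "iter_partial is f \<in> S" for "is"
    by (induction "is") (use assms in auto)
  then show ?thesis
    using diff by (auto simp: smooth_fun_def)
qed

subsection \<open>Symmetry of partial derivatives\<close>

lemma has_real_derivative_partial_deriv:
  fixes f :: "real^'n::finite \<Rightarrow> real"
  assumes "f differentiable (at (x + t *\<^sub>R axis i 1))"
  shows "((\<lambda>t. f (x + t *\<^sub>R axis i 1)) has_real_derivative partial_deriv i f (x + t *\<^sub>R axis i 1)) (at t)"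
proof -
  let ?D = "frechet_derivative f (at (x + t *\<^sub>R axis i 1))"
  have D: "(f has_derivative ?D) (at (x + t *\<^sub>R axis i 1))"
    using assms frechet_derivative_works by blast
  have "((\<lambda>t. x + t *\<^sub>R axis i 1) has_derivative (\<lambda>h. h *\<^sub>R axis i 1)) (at t)"
    by (auto intro!: derivative_eq_intros)
  then have "((\<lambda>t. f (x + t *\<^sub>R axis i 1)) has_derivative (\<lambda>h. ?D (h *\<^sub>R axis i 1))) (at t)"
    by (rule has_derivative_compose) (use D in simp)
  moreover have "?D (h *\<^sub>R axis i 1) = partial_deriv i f (x + t *\<^sub>R axis i 1) * h" for h
    using linear_scale[OF has_derivative_linear[OF D]] by (simp add: partial_deriv_def)
  ultimately show ?thesis
    by (simp add: has_field_derivative_def)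
qed

text \<open>The one-variable mean value theorem is used twice: along i for the increment of f in
  direction j, then along j for the i-th partial derivative. The left-hand side is symmetric in i
  and j while the right-hand side is not, which is how mixed derivatives get compared.\<close>

lemma second_difference_MVT:
  fixes f :: "real^'n::finite \<Rightarrow> real"
  assumes f: "smooth_fun f" and h: "0 < h"
  obtains s t where "0 < s" "s < h" "0 < t" "t < h"
    "f (x + h *\<^sub>R axis i 1 + h *\<^sub>R axis j 1) - f (x + h *\<^sub>R axis i 1) - f (x + h *\<^sub>R axis j 1) + f x
       = h\<^sup>2 * partial_deriv j (partial_deriv i f) (x + s *\<^sub>R axis i 1 + t *\<^sub>R axis j 1)"
proof -
  define g where "g = (\<lambda>s. f (x + h *\<^sub>R axis j 1 + s *\<^sub>R axis i 1) - f (x + s *\<^sub>R axis i 1))"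
  have "\<exists>s. 0 < s \<and> s < h \<and> g h - g 0 = (h - 0) * (partial_deriv i f (x + h *\<^sub>R axis j 1 + s *\<^sub>R axis i 1)
      - partial_deriv i f (x + s *\<^sub>R axis i 1))"
    unfolding g_def using f
    by (intro MVT2 h DERIV_diff has_real_derivative_partial_deriv smooth_fun_differentiable)
  then obtain s where s: "0 < s" "s < h" and eq1: "g h - g 0 = h * (partial_deriv i f (x + h *\<^sub>R axis j 1 + s *\<^sub>R axis i 1)
      - partial_deriv i f (x + s *\<^sub>R axis i 1))" by auto
  define k where "k = (\<lambda>t. partial_deriv i f (x + s *\<^sub>R axis i 1 + t *\<^sub>R axis j 1))"
  have "\<exists>t. 0 < t \<and> t < h \<and> k h - k 0 = (h - 0) * partial_deriv j (partial_deriv i f) (x + s *\<^sub>R axis i 1 + t *\<^sub>R axis j 1)"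
    unfolding k_def using f
    by (intro MVT2 h has_real_derivative_partial_deriv smooth_fun_differentiable smooth_fun_partial_deriv)
  then obtain t where t: "0 < t" "t < h" and
    eq2: "k h - k 0 = h * partial_deriv j (partial_deriv i f) (x + s *\<^sub>R axis i 1 + t *\<^sub>R axis j 1)" by auto
  have "f (x + h *\<^sub>R axis i 1 + h *\<^sub>R axis j 1) - f (x + h *\<^sub>R axis i 1) - f (x + h *\<^sub>R axis j 1) + f x = g h - g 0"
    by (simp add: g_def algebra_simps)
  also have "\<dots> = h * (k h - k 0)"
    by (simp add: eq1 k_def algebra_simps)
  finally show ?thesis
    using that[OF s t] by (simp add: eq2 power2_eq_square)
qed

text \<open>Smoothness makes the mixed derivative continuous, so the intermediate points, squeezed
  towards x by h n, disappear in the limit.\<close>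

lemma second_difference_quotient_tendsto:
  fixes f :: "real^'n::finite \<Rightarrow> real"
  assumes f: "smooth_fun f" and h0: "\<And>n. 0 < h n" and hlim: "h \<longlonglongrightarrow> 0"
  shows "(\<lambda>n. (f (x + h n *\<^sub>R axis i 1 + h n *\<^sub>R axis j 1) - f (x + h n *\<^sub>R axis i 1)
      - f (x + h n *\<^sub>R axis j 1) + f x) / (h n)\<^sup>2) \<longlonglongrightarrow> partial_deriv j (partial_deriv i f) x"
proof -
  define F where "F = partial_deriv j (partial_deriv i f)"
  have F: "smooth_fun F"
    unfolding F_def by (intro smooth_fun_partial_deriv f)
  define Q where "Q = (\<lambda>n s t. 0 < s \<and> s < h n \<and> 0 < t \<and> t < h n \<and>
    f (x + h n *\<^sub>R axis i 1 + h n *\<^sub>R axis j 1) - f (x + h n *\<^sub>R axis i 1) - f (x + h n *\<^sub>R axis j 1) + f x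
       = (h n)\<^sup>2 * F (x + s *\<^sub>R axis i 1 + t *\<^sub>R axis j 1))"
  have "\<exists>s t. Q n s t" for n
    unfolding Q_def F_def by (rule second_difference_MVT[OF f h0[of n], of x i j]) blast
  then obtain s t where st: "\<And>n. Q n (s n) (t n)" by metis
  have "s \<longlonglongrightarrow> 0" "t \<longlonglongrightarrow> 0"
    by (rule tendsto_sandwich[OF _ _ tendsto_const hlim];
        use st in \<open>auto simp: Q_def intro!: always_eventually less_imp_le\<close>)+
  then have "(\<lambda>n. x + s n *\<^sub>R axis i 1 + t n *\<^sub>R axis j 1) \<longlonglongrightarrow> x + 0 *\<^sub>R axis i 1 + 0 *\<^sub>R axis j (1::real)"
    by (intro tendsto_intros)
  then have "(\<lambda>n. F (x + s n *\<^sub>R axis i 1 + t n *\<^sub>R axis j 1)) \<longlonglongrightarrow> F x"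
    using isCont_tendsto_compose[of x F] differentiable_imp_continuous_within[OF smooth_fun_differentiable[OF F]]
    by simp
  moreover have "F (x + s n *\<^sub>R axis i 1 + t n *\<^sub>R axis j 1) =
      (f (x + h n *\<^sub>R axis i 1 + h n *\<^sub>R axis j 1) - f (x + h n *\<^sub>R axis i 1)
      - f (x + h n *\<^sub>R axis j 1) + f x) / (h n)\<^sup>2" for n
    using st[of n] h0[of n] by (auto simp: Q_def field_simps)
  ultimately show ?thesis
    by (simp add: F_def)
qed

text \<open>Exchanging i and j leaves the second difference quotient unchanged, so both mixed
  derivatives are limits of one sequence.\<close>

lemma partial_deriv_commute:
  fixes f :: "real^'n::finite \<Rightarrow> real"
  assumes f: "smooth_fun f"
  shows "partial_deriv i (partial_deriv j f) = partial_deriv j (partial_deriv i f)"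
proof
  fix x
  note lim = second_difference_quotient_tendsto[OF f _ LIMSEQ_inverse_real_of_nat, of x]
  show "partial_deriv i (partial_deriv j f) x = partial_deriv j (partial_deriv i f) x"
    using lim[of i j] lim[of j i] by (intro LIMSEQ_unique[OF lim[of j i]]) (simp_all add: algebra_simps)
qed

lemma iter_partial_remove1:
  assumes f: "smooth_fun f" and "i \<in> set is"
  shows "iter_partial is f = partial_deriv i (iter_partial (remove1 i is) f)"
  using assms(2)
proof (induction "is")
  case (Cons j "is")
  show ?case
  proof (cases "j = i")
    case False
    with Cons have "iter_partial (j # is) f = partial_deriv j (partial_deriv i (iter_partial (remove1 i is) f))"
      by simp
    also have "\<dots> = partial_deriv i (partial_deriv j (iter_partial (remove1 i is) f))"
      by (intro partial_deriv_commute smooth_fun_iter_partial f)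
    finally show ?thesis using False by simp
  qed simp
qed simp

text \<open>Lists with equal counts are permutations of each other, and commuting derivatives bring
  the head of one list to the front of the other. This makes the list picked inside
  \<open>mi_partial\<close> irrelevant for smooth functions.\<close>

lemma iter_partial_cong_count:
  assumes f: "smooth_fun f" and "count_list is = count_list js"
  shows "iter_partial is f = iter_partial js f"
  using assms(2)
proof (induction "is" arbitrary: js)
  case Nil
  then have "count_list js i = 0" for i by (metis count_list.simps(1))
  then have "js = []" by (metis count_list_0_iff list.set_intros(1) neq_Nil_conv)
  then show ?case by simp
next
  case (Cons i "is")
  have i: "i \<in> set js"
    using fun_cong[OF Cons.prems, of i] by (metis count_list_0_iff list.set_intros(1))
  have "count_list is = count_list (remove1 i js)"
  proof
    fix k show "count_list is k = count_list (remove1 i js) k"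
      using fun_cong[OF Cons.prems, of k] by auto
  qed
  then have "iter_partial is f = iter_partial (remove1 i js) f"
    by (rule Cons.IH)
  then show ?case
    using iter_partial_remove1[OF f i] by simp
qed

text \<open>Provides, for each multi-index, a list along which the weak derivative of the
  composition is expanded.\<close>

lemma exists_count_list: "\<exists>is :: 'n::finite list. \<forall>i. count_list is i = \<alpha> i"
proof -
  have "\<exists>is. \<forall>i. count_list is i = (if i \<in> S then \<alpha> i else 0)" if "finite S" for S
    using that
  proof induction
    case empty
    show ?case by (auto intro: exI[of _ "[]"])
  next
    case (insert x S)
    then obtain "is" where "is": "\<forall>i. count_list is i = (if i \<in> S then \<alpha> i else 0)" by auto
    have rep: "count_list (replicate n x) i = (if i = x then n else 0)" for n i
      by (induction n) auto
    show ?case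
      by (rule exI[of _ "replicate (\<alpha> x) x @ is"]) (use "is" insert.hyps in \<open>auto simp: rep\<close>)
  qed
  from this[of UNIV] show ?thesis by simp
qed

lemma mi_order_count_list: "mi_order (count_list is) = length is"
proof (induction "is")
  case (Cons i "is")
  have "mi_order (count_list (i # is)) = (\<Sum>j\<in>UNIV. count_list is j + (if j = i then 1 else 0))"
    unfolding mi_order_def by (intro sum.cong) auto
  then show ?case
    using Cons by (simp add: sum.distrib mi_order_def)
qed (simp add: mi_order_def)

subsection \<open>Affine substitution\<close>

lemma has_derivative_aff_map: "(aff_map A c has_derivative (*v) A) (at x)"
proof -
  have "((\<lambda>x. A *v x + c) has_derivative (*v) A) (at x)"
    by (rule has_derivative_add_const) (rule bounded_linear_imp_has_derivative, simp)
  then show ?thesis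
    by (simp add: aff_map_def[abs_def])
qed

lemma continuous_on_aff_map: "continuous_on S (aff_map A c)"
  unfolding aff_map_def by (intro continuous_intros)

lemma matrix_vector_axis: "A *v axis j (1::real) = (\<Sum>i\<in>UNIV. A $ i $ j *\<^sub>R axis i 1)"
  unfolding matrix_vector_mult_basis by (simp add: vec_eq_iff column_def axis_def if_distrib cong: if_cong)

lemma differentiable_aff_map:
  "g differentiable (at (aff_map A c x)) \<Longrightarrow> (\<lambda>x. g (aff_map A c x)) differentiable (at x)"
  using has_derivative_compose[OF has_derivative_aff_map] unfolding differentiable_def by blast

lemma partial_deriv_aff_map:
  assumes "g differentiable (at (aff_map A c x))"
  shows "partial_deriv j (\<lambda>x. g (aff_map A c x)) x = (\<Sum>i\<in>UNIV. A $ i $ j * partial_deriv i g (aff_map A c x))"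
proof -
  let ?D = "frechet_derivative g (at (aff_map A c x))"
  have D: "(g has_derivative ?D) (at (aff_map A c x))"
    using assms frechet_derivative_works by blast
  have "linear ?D"
    by (rule has_derivative_linear[OF D])
  then have "?D (A *v axis j 1) = (\<Sum>i\<in>UNIV. A $ i $ j * ?D (axis i 1))"
    unfolding matrix_vector_axis by (simp add: linear_sum linear_scale)
  then show ?thesis
    unfolding partial_derivI[OF has_derivative_compose[OF has_derivative_aff_map D]]
    by (simp add: partial_deriv_def)
qed

text \<open>The coefficient of \<open>iter_partial is f\<close> in the derivative along
  \<open>js\<close> of f after an affine map. \<open>map2\<close> truncates to the shorter list, so
  only lists of equal length are meant.\<close>

definition chain_coeff :: "real^'n^'m \<Rightarrow> 'm list \<Rightarrow> 'n list \<Rightarrow> real" where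
  "chain_coeff A is js = prod_list (map2 (\<lambda>i j. A $ i $ j) is js)"

lemma finite_lists_length: "finite {is :: 'n::finite list. length is = l}"
  using finite_lists_length_eq[of "UNIV :: 'n set" l] by simp

lemma sum_lists_Suc:
  "(\<Sum>is | length is = Suc l. h is) = (\<Sum>i\<in>(UNIV::'n::finite set). \<Sum>is | length is = l. h (i # is))"
proof -
  have "(\<Sum>is | length is = Suc l. h is) = (\<Sum>(i, is)\<in>UNIV \<times> {is. length is = l}. h (i # is))"
    by (rule sum.reindex_bij_witness[of _ "\<lambda>(i, is). i # is" "\<lambda>is. (hd is, tl is)"])
       (auto simp: length_Suc_conv)
  then show ?thesis
    by (simp add: sum.cartesian_product)
qed

text \<open>The Jacobian is constant, so no derivative ever falls on a coefficient and each
  induction step is a first-order chain rule applied to every term.\<close>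

lemma iter_partial_aff_map:
  assumes f: "smooth_fun f"
  shows "iter_partial js (\<lambda>x. f (aff_map A c x)) =
    (\<lambda>x. \<Sum>is | length is = length js. chain_coeff A is js * iter_partial is f (aff_map A c x))"
proof (induction js)
  case Nil
  show ?case by (simp add: chain_coeff_def)
next
  case (Cons j js)
  note diff = smooth_fun_differentiable[OF smooth_fun_iter_partial[OF f]]
  show ?case
  proof
    fix x
    let ?g = "\<lambda>is x. chain_coeff A is js * iter_partial is f (aff_map A c x)"
    have "((\<lambda>x. iter_partial is f (aff_map A c x)) has_derivative
        frechet_derivative (\<lambda>x. iter_partial is f (aff_map A c x)) (at x)) (at x)" for "is"
      using differentiable_aff_map[OF diff] frechet_derivative_works by blast
    then have "((\<lambda>x. \<Sum>is | length is = length js. ?g is x) has_derivative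
        (\<lambda>h. \<Sum>is | length is = length js. chain_coeff A is js *
          frechet_derivative (\<lambda>x. iter_partial is f (aff_map A c x)) (at x) h)) (at x)"
      by (intro has_derivative_sum has_derivative_mult_right)
    from partial_derivI[OF this, of j]
    have "iter_partial (j # js) (\<lambda>x. f (aff_map A c x)) x =
        (\<Sum>is | length is = length js. chain_coeff A is js * partial_deriv j (\<lambda>x. iter_partial is f (aff_map A c x)) x)"
      by (simp add: Cons partial_deriv_def)
    also have "\<dots> = (\<Sum>is | length is = length js. \<Sum>i\<in>UNIV.
        chain_coeff A (i # is) (j # js) * iter_partial (i # is) f (aff_map A c x))"
      by (simp add: partial_deriv_aff_map[OF diff] chain_coeff_def sum_distrib_left mult_ac)
    also have "\<dots> = (\<Sum>is | length is = length (j # js).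
        chain_coeff A is (j # js) * iter_partial is f (aff_map A c x))"
      by (subst sum.swap) (simp add: sum_lists_Suc)
    finally show "iter_partial (j # js) (\<lambda>x. f (aff_map A c x)) x =
      (\<Sum>is | length is = length (j # js). chain_coeff A is (j # js) * iter_partial is f (aff_map A c x))" .
  qed
qed

lemma smooth_fun_aff_map:
  assumes f: "smooth_fun f"
  shows "smooth_fun (\<lambda>x. f (aff_map A c x))"
  unfolding smooth_fun_def iter_partial_aff_map[OF f]
  by (intro allI differentiable_sum finite_lists_length ballI differentiable_mult differentiable_const
      differentiable_aff_map smooth_fun_differentiable smooth_fun_iter_partial f)

subsection \<open>Bump functions\<close>

text \<open>For k = 0 this is the classical flat function exp(-1/t). The powers of 1/t are included
  because differentiation produces them, so derivatives stay within linear combinations of the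
  family.\<close>

definition exp_bump :: "nat \<Rightarrow> real \<Rightarrow> real" where
  "exp_bump k t = (if t > 0 then inverse t ^ k * exp (- inverse t) else 0)"

lemma exp_bump_tendsto_0: "(exp_bump k \<longlongrightarrow> 0) (at_right 0)"
proof -
  have "((\<lambda>t. inverse t ^ k / exp (inverse t)) \<longlongrightarrow> (0::real)) (at_right 0)"
    by (rule filterlim_compose[OF tendsto_power_div_exp_0 filterlim_inverse_at_top_right])
  then show ?thesis
    by (rule Lim_transform_eventually)
       (auto simp: eventually_at_filter exp_bump_def exp_minus field_simps)
qed

lemma exp_bump_has_derivative:
  "(exp_bump k has_real_derivative exp_bump (k + 2) t - real k * exp_bump (k + 1) t) (at t)"
proof (cases t "0::real" rule: linorder_cases)
  case less
  have "((\<lambda>t. 0) has_real_derivative 0) (at t)" by simp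
  then have "(exp_bump k has_real_derivative 0) (at t)"
    by (rule has_field_derivative_transform_within_open[of _ _ _ "{..<0}"])
       (use less in \<open>auto simp: exp_bump_def\<close>)
  then show ?thesis
    using less by (simp add: exp_bump_def)
next
  case equal
  have "((\<lambda>h. (exp_bump k (0 + h) - exp_bump k 0) / h) \<longlongrightarrow> 0) (at 0)"
  proof (rule filterlim_split_at)
    show "((\<lambda>h. (exp_bump k (0 + h) - exp_bump k 0) / h) \<longlongrightarrow> 0) (at_left 0)"
      by (rule Lim_transform_eventually[OF tendsto_const])
         (auto simp: eventually_at_filter exp_bump_def)
    show "((\<lambda>h. (exp_bump k (0 + h) - exp_bump k 0) / h) \<longlongrightarrow> 0) (at_right 0)"
      \<comment> \<open>For h > 0 the difference quotient at 0 is exactly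
        \<open>exp_bump (Suc k) h\<close>.\<close>
      by (rule Lim_transform_eventually[OF exp_bump_tendsto_0[of "Suc k"]])
         (auto simp: eventually_at_filter exp_bump_def field_simps)
  qed
  then show ?thesis
    using equal by (simp add: DERIV_def exp_bump_def)
next
  case greater
  have "((\<lambda>t. inverse t ^ k * exp (- inverse t)) has_real_derivative
      (real k * inverse t ^ (k - 1) * - (inverse t)\<^sup>2) * exp (- inverse t)
        + inverse t ^ k * (exp (- inverse t) * (inverse t)\<^sup>2)) (at t)"
    using greater by (auto intro!: derivative_eq_intros simp: power2_eq_square)
  moreover have "(real k * inverse t ^ (k - 1) * - (inverse t)\<^sup>2) * exp (- inverse t)
      + inverse t ^ k * (exp (- inverse t) * (inverse t)\<^sup>2) = exp_bump (k + 2) t - real k * exp_bump (k + 1) t"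
    \<comment> \<open>The case split is for the exponent \<open>k - 1\<close>, which truncates at k
      = 0, where the factor \<open>real k\<close> vanishes.\<close>
    using greater by (cases k) (simp_all add: exp_bump_def power2_eq_square algebra_simps)
  ultimately have "((\<lambda>t. inverse t ^ k * exp (- inverse t)) has_real_derivative
      exp_bump (k + 2) t - real k * exp_bump (k + 1) t) (at t)"
    by (simp only:)
  then show ?thesis
    by (rule has_field_derivative_transform_within_open[of _ _ _ "{0<..}"])
       (use greater in \<open>auto simp: exp_bump_def\<close>)
qed

text \<open>Tailored to contain \<open>box_bump\<close> and to be stable under
  \<open>partial_deriv\<close>: sums come from the product rule, constants from the inner derivative
  of an affine argument.\<close>

inductive_set bump_algebra :: "(real^'n::finite \<Rightarrow> real) set" where
  const: "(\<lambda>_. a) \<in> bump_algebra"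
| bump: "(\<lambda>x. exp_bump k (a * x $ j + d)) \<in> bump_algebra"
| add: "f \<in> bump_algebra \<Longrightarrow> g \<in> bump_algebra \<Longrightarrow> (\<lambda>x. f x + g x) \<in> bump_algebra"
| mult: "f \<in> bump_algebra \<Longrightarrow> g \<in> bump_algebra \<Longrightarrow> (\<lambda>x. f x * g x) \<in> bump_algebra"

lemma bump_algebra_closed:
  assumes "f \<in> bump_algebra"
  shows "f differentiable (at x)" "partial_deriv i f \<in> bump_algebra"
proof -
  \<comment> \<open>Both claims share one induction: the derivative of a product can only be
    computed once its factors are known to be differentiable.\<close>
  have "(\<forall>x. f differentiable (at x)) \<and> (\<forall>i. partial_deriv i f \<in> bump_algebra)"
    using assms
  proof induction
    case (const a)
    have "partial_deriv i (\<lambda>_. a) = (\<lambda>_. 0)" for i :: 'a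
      by (rule ext, subst partial_derivI[OF has_derivative_const]) simp
    then show ?case by (simp add: bump_algebra.const)
  next
    case (bump k a j d)
    have D: "((\<lambda>x. exp_bump k (a * x $ j + d)) has_derivative
      (\<lambda>h. (exp_bump (k + 2) (a * x $ j + d) - real k * exp_bump (k + 1) (a * x $ j + d)) * (a * h $ j))) (at x)" for x :: "real^'a"
      by (rule has_derivative_compose[OF _ exp_bump_has_derivative[unfolded has_field_derivative_def]])
         (auto intro!: derivative_eq_intros bounded_linear_imp_has_derivative bounded_linear_vec_nth)
    have "partial_deriv i (\<lambda>x. exp_bump k (a * x $ j + d)) =
      (\<lambda>x. (exp_bump (k + 2) (a * x $ j + d) + (- real k) * exp_bump (k + 1) (a * x $ j + d)) * (a * axis i 1 $ j))" for i
      by (rule ext, subst partial_derivI[OF D]) simp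
    then have "partial_deriv i (\<lambda>x. exp_bump k (a * x $ j + d)) \<in> bump_algebra" for i
      by (simp only:) (intro bump_algebra.intros)
    then show ?case using D unfolding differentiable_def by blast
  next
    case (add f g)
    have D: "((\<lambda>x. f x + g x) has_derivative (\<lambda>h. frechet_derivative f (at x) h + frechet_derivative g (at x) h)) (at x)" for x
      using add frechet_derivative_works by (intro has_derivative_add) blast+
    have "partial_deriv i (\<lambda>x. f x + g x) = (\<lambda>x. partial_deriv i f x + partial_deriv i g x)" for i
      by (rule ext, subst partial_derivI[OF D]) (simp add: partial_deriv_def)
    then have "partial_deriv i (\<lambda>x. f x + g x) \<in> bump_algebra" for i
      using add by (simp only:) (intro bump_algebra.intros; blast)
    then show ?case using D unfolding differentiable_def by blast
  next
    case (mult f g)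
    have D: "((\<lambda>x. f x * g x) has_derivative (\<lambda>h. f x * frechet_derivative g (at x) h + frechet_derivative f (at x) h * g x)) (at x)" for x
      using mult frechet_derivative_works by (intro has_derivative_mult) blast+
    have "partial_deriv i (\<lambda>x. f x * g x) = (\<lambda>x. f x * partial_deriv i g x + partial_deriv i f x * g x)" for i
      by (rule ext, subst partial_derivI[OF D]) (simp add: partial_deriv_def)
    then have "partial_deriv i (\<lambda>x. f x * g x) \<in> bump_algebra" for i
      using mult by (simp only:) (intro bump_algebra.intros; blast)
    then show ?case using D unfolding differentiable_def by blast
  qed
  then show "f differentiable (at x)" "partial_deriv i f \<in> bump_algebra" by auto
qed

lemma smooth_fun_bump_algebra: "f \<in> bump_algebra \<Longrightarrow> smooth_fun f"
  by (erule smooth_fun_coinduct) (auto intro: bump_algebra_closed)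

lemma bump_algebra_prod:
  assumes "finite I" "\<And>i. i \<in> I \<Longrightarrow> f i \<in> bump_algebra"
  shows "(\<lambda>x. \<Prod>i\<in>I. f i x) \<in> bump_algebra"
  using assms by induction (auto intro: bump_algebra.intros)

text \<open>r is a steepness, not a radius. For every r > 0 the function vanishes off the open box;
  as r grows, each factor at a fixed point of the box tends to exp 0 = 1, so the limit is an
  indicator without normalisation.\<close>

definition box_bump :: "real^'n::finite \<Rightarrow> real^'n \<Rightarrow> real \<Rightarrow> real^'n \<Rightarrow> real" where
  "box_bump a b r x = (\<Prod>j\<in>UNIV. exp_bump 0 (r * (x $ j - a $ j)) * exp_bump 0 (r * (b $ j - x $ j)))"

lemma smooth_fun_box_bump: "smooth_fun (box_bump a b r)"
proof -
  have "(\<lambda>x. exp_bump 0 (r * (x $ j - a $ j)) * exp_bump 0 (r * (b $ j - x $ j))) \<in> bump_algebra" for j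
    using bump_algebra.mult[OF bump_algebra.bump[of 0 r j "- r * a $ j"] bump_algebra.bump[of 0 "- r" j "r * b $ j"]]
    by (simp add: algebra_simps)
  then have "box_bump a b r \<in> bump_algebra"
    unfolding box_bump_def[abs_def] by (intro bump_algebra_prod) auto
  then show ?thesis by (rule smooth_fun_bump_algebra)
qed

lemma box_bump_eq_0:
  assumes "0 < r" "x \<notin> box a b"
  shows "box_bump a b r x = 0"
proof -
  obtain j where "\<not> (a $ j < x $ j \<and> x $ j < b $ j)"
    using assms by (auto simp: mem_box_cart)
  then have "exp_bump 0 (r * (x $ j - a $ j)) * exp_bump 0 (r * (b $ j - x $ j)) = 0"
    using assms by (auto simp: exp_bump_def zero_less_mult_iff)
  then show ?thesis
    by (auto simp: box_bump_def)
qed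

lemma exp_bump_nonneg: "0 \<le> exp_bump k t" and exp_bump_0_le_1: "exp_bump 0 t \<le> 1"
  by (auto simp: exp_bump_def)

lemma box_bump_bounds: "0 \<le> box_bump a b r x" "box_bump a b r x \<le> 1"
  unfolding box_bump_def
  by (auto intro!: prod_nonneg prod_le_1 mult_le_one mult_nonneg_nonneg exp_bump_nonneg exp_bump_0_le_1)

lemma box_bump_test_fun:
  assumes "cbox a b \<subseteq> U" "0 < r"
  shows "box_bump a b r \<in> test_funs U"
proof -
  have "closure {x. box_bump a b r x \<noteq> 0} \<subseteq> cbox a b"
    using box_bump_eq_0[OF assms(2)] box_subset_cbox by (intro closure_minimal) blast+
  moreover from this have "compact (closure {x. box_bump a b r x \<noteq> 0})"
    by (meson bounded_cbox bounded_subset closed_closure compact_eq_bounded_closed)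
  ultimately show ?thesis
    using assms smooth_fun_box_bump by (auto simp: test_funs_def)
qed

lemma exp_bump_0_tendsto_1:
  assumes "0 < t"
  shows "(\<lambda>n. exp_bump 0 (real (Suc n) * t)) \<longlonglongrightarrow> 1"
proof -
  have "(\<lambda>n. exp (- (inverse (real (Suc n)) * inverse t))) \<longlonglongrightarrow> exp (- (0 * inverse t))"
    by (intro tendsto_intros LIMSEQ_inverse_real_of_nat)
  then show ?thesis
    using assms by (simp add: exp_bump_def zero_less_mult_iff)
qed

lemma box_bump_tendsto:
  fixes a b x :: "real^'n::finite"
  shows "(\<lambda>n. box_bump a b (real (Suc n)) x) \<longlonglongrightarrow> indicator (box a b) x"
proof (cases "x \<in> box a b")
  case True
  have "(\<lambda>n. box_bump a b (real (Suc n)) x) \<longlonglongrightarrow> (\<Prod>j\<in>(UNIV :: 'n set). 1 * 1)"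
    unfolding box_bump_def
    by (intro tendsto_prod tendsto_mult exp_bump_0_tendsto_1; use True in \<open>simp add: mem_box_cart\<close>)
  with True show ?thesis by simp
qed (simp add: box_bump_eq_0 del: of_nat_Suc)

section \<open>Change of variables for affine maps\<close>

text \<open>A coordinate swap is an involution, so the image is itself a box, with permuted side
  lengths.\<close>

lemma measure_swap_cbox:
  fixes a b :: "real^'n::finite"
  assumes "m \<noteq> n"
  shows "measure lebesgue ((\<lambda>x. \<chi> i. x $ Transposition.transpose m n i) ` cbox a b) = measure lebesgue (cbox a b)"
    (is "measure lebesgue (?h ` _) = _")
proof (cases "cbox a b = {}")
  case False
  have inv: "?h (?h x) = x" for x :: "real^'n"
    by (simp add: vec_eq_iff)
  have mem: "?h x \<in> cbox (?h a) (?h b) \<longleftrightarrow> x \<in> cbox a b" for x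
    unfolding mem_box_cart by (simp, metis transpose_involutory)
  have "?h ` cbox a b = cbox (?h a) (?h b)"
  proof (intro equalityI subsetI)
    fix x assume "x \<in> cbox (?h a) (?h b)"
    then have "?h x \<in> cbox a b" "x = ?h (?h x)" using mem[of "?h x"] by (simp_all only: inv)
    then show "x \<in> ?h ` cbox a b" by (rule rev_image_eqI)
  qed (use mem in blast)
  moreover have "cbox (?h a) (?h b) \<noteq> {}" using False calculation by blast
  moreover have "(\<Prod>i\<in>UNIV. ?h b $ i - ?h a $ i) = (\<Prod>i\<in>UNIV. b $ i - a $ i)"
    by (subst prod.permute[OF permutes_swap_id[of m UNIV n]]) (simp_all add: o_def)
  ultimately show ?thesis
    using False by (simp add: content_cbox_cart)
qed simp

text \<open>The shear is additive, so a translation of the box becomes a translation of the image.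
  Moving the lower corner to 0 brings the box into the range of
  \<open>measure_shear_interval\<close>.\<close>

lemma measure_shear_cbox:
  fixes a b :: "real^'n::finite"
  assumes "m \<noteq> n"
  shows "measure lebesgue ((\<lambda>x. \<chi> i. if i = m then x$m + x$n else x$i) ` cbox a b) = measure lebesgue (cbox a b)"
    (is "measure lebesgue (?h ` _) = _")
proof (cases "cbox a b = {}")
  case False
  have shift: "cbox a b = (+) a ` cbox 0 (b - a)"
    using cbox_translation[of a 0 "b - a"] by simp
  have "?h (a + x) = ?h a + ?h x" for x
    by (simp add: vec_eq_iff)
  then have "?h ` cbox a b = (+) (?h a) ` ?h ` cbox 0 (b - a)"
    unfolding shift image_image by simp
  moreover have "measure lebesgue (?h ` cbox 0 (b - a)) = measure lebesgue (cbox 0 (b - a))"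
    by (rule measure_shear_interval[OF assms]) (use False shift in auto)
  ultimately show ?thesis
    by (simp add: measure_translation shift)
qed simp

text \<open>The library version of this fact assumes a well-ordered index type.\<close>

lemma lmeasurable_measure_linear_image:
  fixes f :: "real^'n::finite \<Rightarrow> real^'n"
  assumes "linear f" "S \<in> lmeasurable"
  shows "f ` S \<in> lmeasurable \<and> measure lebesgue (f ` S) = \<bar>det (matrix f)\<bar> * measure lebesgue S"
proof -
  define P where "P f \<longleftrightarrow> (\<forall>S \<in> lmeasurable. f ` S \<in> lmeasurable \<and>
    measure lebesgue (f ` S) = \<bar>det (matrix f)\<bar> * measure lebesgue S)" for f :: "real^'n \<Rightarrow> real^'n"
  \<comment> \<open>For a linear map with determinant of modulus 1 it suffices to look at boxes;
    this serves the swaps and the shears.\<close>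
  have P_preserving: "P h" if lin: "linear h" and det: "\<bar>det (matrix h)\<bar> = 1"
    and cbox: "\<And>a b. measure lebesgue (h ` cbox a b) = measure lebesgue (cbox a b)" for h
    unfolding P_def
  proof
    fix S :: "(real^'n) set" assume "S \<in> lmeasurable"
    from measure_linear_sufficient[OF lin this, of 1] cbox det
    show "h ` S \<in> lmeasurable \<and> measure lebesgue (h ` S) = \<bar>det (matrix h)\<bar> * measure lebesgue S"
      by simp
  qed
  have "P f"
    using assms(1)
  proof (rule induct_linear_elementary)
    fix f g :: "real^'n \<Rightarrow> real^'n"
    assume lin: "linear f" "linear g" and P: "P f" "P g"
    have det: "det (matrix (f \<circ> g)) = det (matrix f) * det (matrix g)"
      by (simp only: matrix_compose[OF lin(2,1)] det_mul)
    show "P (f \<circ> g)"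
      unfolding P_def image_comp[symmetric] det abs_mult
    proof (intro ballI conjI)
      fix S :: "(real^'n) set" assume S: "S \<in> lmeasurable"
      then have gS: "g ` S \<in> lmeasurable" "measure lebesgue (g ` S) = \<bar>det (matrix g)\<bar> * measure lebesgue S"
        using P(2) unfolding P_def by blast+
      then show "f ` g ` S \<in> lmeasurable"
        using P(1) unfolding P_def by blast
      have "measure lebesgue (f ` g ` S) = \<bar>det (matrix f)\<bar> * measure lebesgue (g ` S)"
        using P(1) gS(1) unfolding P_def by blast
      then show "measure lebesgue (f ` g ` S) = \<bar>det (matrix f)\<bar> * \<bar>det (matrix g)\<bar> * measure lebesgue S"
        by (simp only: gS(2) mult.assoc)
    qed
  next
    fix f :: "real^'n \<Rightarrow> real^'n" and i
    assume f: "linear f" and "\<And>x. f x $ i = 0"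
    \<comment> \<open>The rank-deficient case: both sides are 0, the image being negligible and the
      determinant zero.\<close>
    then have "\<not> inj f"
      by (metis (full_types) linear_injective_imp_surjective one_neq_zero surjE vec_component)
    then have "det (matrix f) = 0" "\<And>S. negligible (f ` S)"
      using det_nz_iff_inj[OF f] negligible_linear_singular_image[OF f] by auto
    then show "P f"
      by (simp add: P_def negligible_iff_measure)
  next
    fix c :: "'n \<Rightarrow> real"
    show "P (\<lambda>x. \<chi> i. c i * x $ i)"
      by (simp add: P_def measurable_stretch measure_stretch axis_def matrix_def det_diagonal)
  next
    fix m n :: 'n assume mn: "m \<noteq> n"
    let ?h = "\<lambda>x :: real^'n. \<chi> i. x $ Transposition.transpose m n i"
    have lin: "linear ?h"
      by (rule linearI) (simp_all add: vec_eq_iff)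
    have "matrix ?h = (\<chi> i. mat 1 $ Transposition.transpose m n i)"
      by (auto simp: matrix_def mat_def axis_def vec_eq_iff)
    then have "det (matrix ?h) = of_int (sign (Transposition.transpose m n))"
      by (simp add: det_permute_rows permutes_swap_id)
    then have "\<bar>det (matrix ?h)\<bar> = 1"
      using mn by (simp add: sign_swap_id)
    then show "P ?h"
      by (rule P_preserving[OF lin _ measure_swap_cbox[OF mn]])
  next
    fix m n :: 'n assume mn: "m \<noteq> n"
    let ?h = "\<lambda>x :: real^'n. \<chi> i. if i = m then x$m + x$n else x$i"
    have lin: "linear ?h"
      by (rule linearI) (auto simp: vec_eq_iff algebra_simps)
    have "matrix ?h = (\<chi> k. if k = m then row m (mat 1) + 1 *s row n (mat 1) else row k (mat 1))"
      by (auto simp: matrix_def mat_def axis_def vec_eq_iff row_def)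
    then have "det (matrix ?h) = 1"
      using det_row_operation[OF mn, of "mat 1" 1] by simp
    then show "P ?h"
      by (intro P_preserving[OF lin _ measure_shear_cbox[OF mn]]) simp
  qed
  then show ?thesis
    using assms(2) by (simp add: P_def)
qed

text \<open>Injectivity carries the formula to sets of infinite measure: it makes the determinant
  nonzero, and a left inverse rules out a finite image. All Lebesgue sets are covered because the
  formula is to become an equality of measures.\<close>

lemma emeasure_linear_image:
  fixes f :: "real^'n::finite \<Rightarrow> real^'n"
  assumes f: "linear f" "inj f" and S: "S \<in> sets lebesgue"
  shows "f ` S \<in> sets lebesgue" "emeasure lebesgue (f ` S) = ennreal \<bar>det (matrix f)\<bar> * emeasure lebesgue S"
proof -
  show fS: "f ` S \<in> sets lebesgue"
    by (rule differentiable_image_in_sets_lebesgue)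
       (use S f in \<open>auto simp: linear_imp_differentiable_on\<close>)
  show "emeasure lebesgue (f ` S) = ennreal \<bar>det (matrix f)\<bar> * emeasure lebesgue S"
  proof (cases "S \<in> lmeasurable")
    case True
    with lmeasurable_measure_linear_image[OF f(1) True] show ?thesis
      by (simp add: emeasure_eq_measure2 ennreal_mult)
  next
    case False
    obtain g where g: "linear g" "g \<circ> f = id"
      using linear_injective_left_inverse[OF f] by blast
    have "f ` S \<notin> lmeasurable"
    proof
      assume "f ` S \<in> lmeasurable"
      then have "g ` f ` S \<in> lmeasurable"
        using lmeasurable_measure_linear_image[OF g(1)] by blast
      with False g show False by (simp add: image_comp)
    qed
    with False fS S have "emeasure lebesgue (f ` S) = \<infinity>" "emeasure lebesgue S = \<infinity>"
      by (auto simp: fmeasurable_def less_top[symmetric])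
    moreover have "det (matrix f) \<noteq> 0"
      using det_nz_iff_inj[OF f(1)] f(2) by simp
    ultimately show ?thesis
      by (simp add: ennreal_mult_top)
  qed
qed

section \<open>Push-forward of Lebesgue measure by an invertible affine map\<close>

context
  fixes A :: "real^'n::finite^'n"
  assumes det_nz: "det A \<noteq> 0"
begin

lemma matrix_inv_mult: "matrix_inv A ** A = mat 1" "A ** matrix_inv A = mat 1"
proof -
  have "\<exists>B. A ** B = mat 1 \<and> B ** A = mat 1"
    using det_nz by (simp add: invertible_det_nz[symmetric] invertible_def)
  from someI_ex[OF this] show "matrix_inv A ** A = mat 1" "A ** matrix_inv A = mat 1"
    by (simp_all add: matrix_inv_def)
qed

lemma det_matrix_inv: "det (matrix_inv A) = inverse (det A)"
proof -
  have "det A * det (matrix_inv A) = 1"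
    by (simp add: matrix_inv_mult flip: det_mul)
  then show ?thesis
    by (simp add: inverse_unique)
qed

lemma det_matrix_inv_nz: "det (matrix_inv A) \<noteq> 0"
  by (simp add: det_matrix_inv det_nz)

abbreviation (input) "aff_inv c \<equiv> aff_map (matrix_inv A) (- (matrix_inv A *v c))"

lemma aff_map_inverse: "aff_inv c (aff_map A c x) = x" "aff_map A c (aff_inv c y) = y"
proof -
  show "aff_inv c (aff_map A c x) = x"
    unfolding aff_map_def matrix_vector_right_distrib matrix_vector_mul_assoc matrix_inv_mult by simp
  have "aff_map A c (aff_inv c y) = A *v (matrix_inv A *v (y - c)) + c"
    by (simp add: aff_map_def matrix_vector_mult_diff_distrib)
  then show "aff_map A c (aff_inv c y) = y"
    unfolding matrix_vector_mul_assoc matrix_inv_mult by simp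
qed

lemma vimage_aff_map: "aff_map A c -` S = aff_inv c ` S"
proof (intro equalityI subsetI)
  fix x assume "x \<in> aff_map A c -` S"
  then show "x \<in> aff_inv c ` S"
    by (intro rev_image_eqI[of "aff_map A c x"]) (auto simp: aff_map_inverse)
qed (auto simp: aff_map_inverse)

lemma vimage_aff_map_lebesgue:
  assumes "S \<in> sets lebesgue"
  shows "aff_map A c -` S \<in> sets lebesgue"
    and "emeasure lebesgue (aff_map A c -` S) = ennreal (1 / \<bar>det A\<bar>) * emeasure lebesgue S"
proof -
  let ?B = "matrix_inv A" and ?b = "- (matrix_inv A *v c)"
  have eq: "aff_map A c -` S = (+) ?b ` ((*v) ?B) ` S"
    unfolding vimage_aff_map by (simp add: aff_map_def image_image add.commute)
  have "inj ((*v) ?B)"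
    using det_nz_iff_inj[of "(*v) ?B"] det_matrix_inv_nz by simp
  note lin = emeasure_linear_image[OF matrix_vector_mul_linear this assms]
  then show "aff_map A c -` S \<in> sets lebesgue"
    unfolding eq by (intro lebesgue_sets_translation)
  have "emeasure lebesgue ((+) ?b ` ((*v) ?B) ` S) = emeasure lebesgue (((*v) ?B) ` S)"
    using emeasure_lebesgue_affine[of 1 ?b] by (simp add: add.commute)
  then show "emeasure lebesgue (aff_map A c -` S) = ennreal (1 / \<bar>det A\<bar>) * emeasure lebesgue S"
    unfolding eq by (simp only: lin matrix_of_matrix_vector_mul det_matrix_inv abs_inverse inverse_eq_divide abs_divide abs_one)
qed

context
  fixes c :: "real^'n" and V :: "(real^'n) set"
  assumes V: "V \<in> sets lebesgue"
begin

lemma measurable_aff_map: "aff_map A c \<in> lebesgue_on (aff_map A c -` V) \<rightarrow>\<^sub>M lebesgue_on V"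
proof (rule measurableI)
  fix S assume "S \<in> sets (lebesgue_on V)"
  then have "S \<subseteq> V" "S \<in> sets lebesgue"
    using V by (auto simp: sets_restrict_space_iff)
  then show "aff_map A c -` S \<inter> space (lebesgue_on (aff_map A c -` V)) \<in> sets (lebesgue_on (aff_map A c -` V))"
    using V by (auto simp: sets_restrict_space_iff vimage_aff_map_lebesgue)
qed auto

text \<open>Stating the change of variables as an identity of measures lets null sets, integrability
  and integrals all be transferred by the general rules for \<open>distr\<close> and
  \<open>density\<close>.\<close>

lemma distr_aff_map:
  "distr (lebesgue_on (aff_map A c -` V)) (lebesgue_on V) (aff_map A c)
    = density (lebesgue_on V) (\<lambda>_. ennreal (1 / \<bar>det A\<bar>))"
proof (rule measure_eqI)
  fix S assume "S \<in> sets (distr (lebesgue_on (aff_map A c -` V)) (lebesgue_on V) (aff_map A c))"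
  then have SV: "S \<in> sets (lebesgue_on V)" by simp
  then have S: "S \<subseteq> V" "S \<in> sets lebesgue"
    using V by (auto simp: sets_restrict_space_iff)
  have "emeasure (distr (lebesgue_on (aff_map A c -` V)) (lebesgue_on V) (aff_map A c)) S
      = emeasure (lebesgue_on (aff_map A c -` V)) (aff_map A c -` S)"
    using S by (subst emeasure_distr[OF measurable_aff_map SV]) (auto simp: Int_absorb2 vimage_mono)
  also have "\<dots> = emeasure lebesgue (aff_map A c -` S)"
    using S V by (intro emeasure_restrict_space) (auto simp: vimage_aff_map_lebesgue)
  also have "\<dots> = ennreal (1 / \<bar>det A\<bar>) * emeasure (lebesgue_on V) S"
    using S V by (simp add: vimage_aff_map_lebesgue(2) emeasure_restrict_space del: emeasure_completion)
  also have "\<dots> = emeasure (density (lebesgue_on V) (\<lambda>_. ennreal (1 / \<bar>det A\<bar>))) S"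
    using SV by (simp add: emeasure_density_const)
  finally show "emeasure (distr (lebesgue_on (aff_map A c -` V)) (lebesgue_on V) (aff_map A c)) S
    = emeasure (density (lebesgue_on V) (\<lambda>_. ennreal (1 / \<bar>det A\<bar>))) S" .
qed simp

lemma borel_measurable_aff_map:
  "f \<in> borel_measurable (lebesgue_on V) \<Longrightarrow>
    (\<lambda>x. f (aff_map A c x)) \<in> borel_measurable (lebesgue_on (aff_map A c -` V))"
  by (rule measurable_compose[OF measurable_aff_map])

lemma AE_aff_map:
  assumes "AE x in lebesgue_on V. P x"
  shows "AE x in lebesgue_on (aff_map A c -` V). P (aff_map A c x)"
proof (rule AE_distrD[OF measurable_aff_map])
  show "AE x in distr (lebesgue_on (aff_map A c -` V)) (lebesgue_on V) (aff_map A c). P x"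
    unfolding distr_aff_map using assms by (simp add: AE_density)
qed

lemma integrable_aff_map:
  fixes f :: "real^'n \<Rightarrow> real"
  assumes "integrable (lebesgue_on V) f"
  shows "integrable (lebesgue_on (aff_map A c -` V)) (\<lambda>x. f (aff_map A c x))"
proof (rule integrable_distr[OF measurable_aff_map])
  show "integrable (distr (lebesgue_on (aff_map A c -` V)) (lebesgue_on V) (aff_map A c)) f"
    unfolding distr_aff_map using assms by (subst integrable_density) auto
qed

text \<open>Non-integrable f are covered too: then both integrals have the default value 0.\<close>

lemma integral_aff_map:
  fixes f :: "real^'n \<Rightarrow> real"
  assumes "f \<in> borel_measurable (lebesgue_on V)"
  shows "(LINT x|lebesgue_on (aff_map A c -` V). f (aff_map A c x)) = (LINT x|lebesgue_on V. f x) / \<bar>det A\<bar>"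
proof -
  have "(LINT x|lebesgue_on (aff_map A c -` V). f (aff_map A c x))
      = (LINT x|density (lebesgue_on V) (\<lambda>_. ennreal (1 / \<bar>det A\<bar>)). f x)"
    by (simp only: integral_distr[OF measurable_aff_map assms] flip: distr_aff_map)
  also have "\<dots> = (LINT x|lebesgue_on V. (1 / \<bar>det A\<bar>) *\<^sub>R f x)"
    using assms by (subst integral_density) auto
  finally show ?thesis by simp
qed

end

end

section \<open>Uniqueness of weak derivatives\<close>

text \<open>Local integrability speaks of compact sets only; an open set is a countable union of
  closed boxes, and measurability is patched together from these.\<close>

lemma locally_integrable_on_measurable:
  assumes "open U" "locally_integrable_on g U"
  shows "g \<in> borel_measurable (lebesgue_on U)"
proof -
  obtain D where D: "countable D" "D \<subseteq> Pow U" "\<And>X. X \<in> D \<Longrightarrow> \<exists>a b. X = cbox a b" "\<Union>D = U"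
    using open_countable_Union_open_cbox[OF \<open>open U\<close>] by metis
  show ?thesis
  proof (rule measurable_piecewise_restrict[OF D(1)])
    show "space (lebesgue_on U) \<subseteq> \<Union>D"
      using D(4) by simp
    fix X assume X: "X \<in> D"
    then obtain a b where ab: "X = cbox a b" using D(3) by blast
    have XU: "X \<subseteq> U" using X D by blast
    then have "X \<inter> U = X" by blast
    moreover have "X \<in> sets lebesgue" using ab by simp
    ultimately show "X \<inter> space (lebesgue_on U) \<in> sets (lebesgue_on U)"
      using \<open>open U\<close> XU by (simp add: sets_restrict_space_iff)
    have "g absolutely_integrable_on X"
      using assms(2) XU ab unfolding locally_integrable_on_def by simp
    then have "g \<in> borel_measurable (lebesgue_on X)"
      by (simp add: absolutely_integrable_measurable ab)
    moreover have "restrict_space (lebesgue_on U) X = lebesgue_on X"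
      using \<open>open U\<close> XU by (simp add: restrict_restrict_space Int_absorb1 ab)
    ultimately show "g \<in> borel_measurable (restrict_space (lebesgue_on U) X)"
      by simp
  qed
qed

lemma integrable_lebesgue_on_iff:
  fixes f :: "'a::euclidean_space \<Rightarrow> real"
  assumes "S \<in> sets lebesgue"
  shows "integrable (lebesgue_on S) f \<longleftrightarrow> f absolutely_integrable_on S"
  using assms by (simp add: integrable_restrict_space set_integrable_def)

text \<open>Everything happens on the compact set K, where h is bounded and g is integrable. This
  justifies splitting integrals against test functions and their derivatives.\<close>

lemma locally_integrable_on_mult_integrable:
  fixes h :: "real^'n::finite \<Rightarrow> real"
  assumes "open U" "locally_integrable_on g U" "continuous_on UNIV h"
    and K: "compact K" "K \<subseteq> U" "\<And>x. x \<notin> K \<Longrightarrow> h x = 0"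
  shows "integrable (lebesgue_on U) (\<lambda>x. g x * h x)"
proof -
  have Kl: "K \<in> sets lebesgue"
    using K(1) by (simp add: borel_compact)
  have hK: "continuous_on K h"
    using assms(3) continuous_on_subset by blast
  have "(\<lambda>x. h x * g x) absolutely_integrable_on K"
  proof (rule absolutely_integrable_bounded_measurable_product[OF bilinear_times])
    show "h \<in> borel_measurable (lebesgue_on K)"
      using hK Kl by (rule continuous_imp_measurable_on_sets_lebesgue)
    show "bounded (h ` K)"
      using compact_continuous_image[OF hK K(1)] compact_imp_bounded by blast
    show "g absolutely_integrable_on K"
      using assms(2) K unfolding locally_integrable_on_def by blast
  qed (rule Kl)
  moreover have "(\<lambda>x. indicator K x *\<^sub>R (h x * g x)) = (\<lambda>x. indicator U x *\<^sub>R (g x * h x))"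
    using K(2,3) by (intro ext) (metis indicator_simps mult_zero_left scaleR_one mult.commute scaleR_zero_right subsetD)
  moreover have "U \<in> sets lebesgue"
    using \<open>open U\<close> by simp
  ultimately show ?thesis
    by (simp only: integrable_lebesgue_on_iff set_integrable_def)
qed

lemma indicator_times_subset:
  fixes y :: real
  shows "A \<subseteq> B \<Longrightarrow> indicator B x * (indicator A x * y) = indicator A x * y"
  by (cases "x \<in> A") auto

text \<open>Dominated convergence along box bumps of growing steepness, with |g| on the closed box
  as majorant. The closed box has to lie in U for the bumps to be test functions and the majorant to
  be integrable.\<close>

lemma locally_integrable_on_integral_box:
  assumes U: "open U" and g: "locally_integrable_on g U"
    and zero: "\<And>\<phi>. \<phi> \<in> test_funs U \<Longrightarrow> (LINT x|lebesgue_on U. g x * \<phi> x) = 0"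
    and ab: "cbox a b \<subseteq> U"
  shows "(LINT x|lebesgue. indicator (box a b) x * g x) = 0"
proof -
  have Ul: "U \<in> sets lebesgue"
    using U by simp
  have meas: "g \<in> borel_measurable (lebesgue_on U)"
    by (rule locally_integrable_on_measurable[OF U g])
  have bm: "h \<in> borel_measurable (lebesgue_on U)" if "h \<in> borel_measurable borel" for h :: "real^'a \<Rightarrow> real"
    using that by (intro measurable_restrict_space1 measurable_completion) simp
  have "(\<lambda>n. LINT x|lebesgue_on U. g x * box_bump a b (real (Suc n)) x)
      \<longlonglongrightarrow> (LINT x|lebesgue_on U. g x * indicator (box a b) x)"
  proof (rule integral_dominated_convergence[where w = "\<lambda>x. indicator (cbox a b) x * \<bar>g x\<bar>"])
    show "(\<lambda>x. g x * indicat_real (box a b) x) \<in> borel_measurable (lebesgue_on U)"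
      by (rule borel_measurable_times[OF meas bm]) simp
    show "(\<lambda>x. g x * box_bump a b (real (Suc n)) x) \<in> borel_measurable (lebesgue_on U)" for n
      by (rule borel_measurable_times[OF meas bm[OF borel_measurable_continuous_onI]])
         (rule smooth_fun_continuous_on[OF smooth_fun_box_bump])
    have "g absolutely_integrable_on cbox a b"
      using g ab unfolding locally_integrable_on_def by simp
    then have "(\<lambda>x. \<bar>g x\<bar>) absolutely_integrable_on cbox a b"
      by (rule set_integrable_abs)
    moreover have "(\<lambda>x. indicator (cbox a b) x *\<^sub>R \<bar>g x\<bar>)
        = (\<lambda>x. indicator U x *\<^sub>R (indicator (cbox a b) x * \<bar>g x\<bar>))"
      by (simp only: real_scaleR_def indicator_times_subset[OF ab])
    ultimately show "integrable (lebesgue_on U) (\<lambda>x. indicator (cbox a b) x * \<bar>g x\<bar>)"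
      by (simp only: integrable_lebesgue_on_iff[OF Ul] set_integrable_def)
    show "AE x in lebesgue_on U. (\<lambda>n. g x * box_bump a b (real (Suc n)) x)
        \<longlonglongrightarrow> g x * indicator (box a b) x"
      by (intro AE_I2 tendsto_intros box_bump_tendsto)
    show "AE x in lebesgue_on U. norm (g x * box_bump a b (real (Suc n)) x) \<le> indicator (cbox a b) x * \<bar>g x\<bar>" for n
    proof (rule AE_I2)
      fix x
      show "norm (g x * box_bump a b (real (Suc n)) x) \<le> indicator (cbox a b) x * \<bar>g x\<bar>"
      proof (cases "x \<in> box a b")
        case True
        then have "x \<in> cbox a b" using box_subset_cbox by blast
        then show ?thesis
          using mult_left_mono[OF box_bump_bounds(2), of "\<bar>g x\<bar>"] box_bump_bounds(1)[of a b "real (Suc n)" x]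
          by (simp add: abs_mult del: of_nat_Suc)
      qed (simp add: box_bump_eq_0 del: of_nat_Suc)
    qed
  qed
  moreover have "(LINT x|lebesgue_on U. g x * box_bump a b (real (Suc n)) x) = 0" for n
    by (intro zero box_bump_test_fun ab) simp
  ultimately have "(LINT x|lebesgue_on U. g x * indicator (box a b) x) = 0"
    by (simp add: LIMSEQ_const_iff)
  moreover have "(\<lambda>x. indicator U x *\<^sub>R (g x * indicator (box a b) x)) = (\<lambda>x. indicator (box a b) x * g x)"
    by (simp only: real_scaleR_def mult.commute[of "g _"] indicator_times_subset[OF order_trans[OF box_subset_cbox ab]])
  moreover have "U \<inter> space lebesgue \<in> sets lebesgue"
    using Ul by simp
  ultimately show ?thesis
    by (simp only: integral_restrict_space)
qed

text \<open>A Dynkin argument: the sets over which f integrates to 0 are closed under complements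
  and countable disjoint unions, and boxes form an intersection-stable generator of the Borel sets.
  The vanishing total integral is what the complements consume.\<close>

lemma AE_zero_of_box_integrals:
  fixes f :: "'a::euclidean_space \<Rightarrow> real"
  assumes f: "integrable lebesgue f" "(LINT x|lebesgue. f x) = 0"
    and zero: "\<And>a b. (LINT x|lebesgue. indicator (box a b) x * f x) = 0"
  shows "AE x in lebesgue. f x = 0"
proof -
  \<comment> \<open>Sigma-finiteness gives access to \<open>density_zero\<close>, which concludes
    the proof.\<close>
  interpret sigma_finite_measure "lebesgue :: 'a measure"
  proof
    obtain F :: "'a set set" where F: "countable F" "F \<subseteq> sets lborel" "\<Union>F = space lborel"
      "\<forall>a\<in>F. emeasure lborel a \<noteq> \<infinity>"
      using lborel.sigma_finite_countable by metis
    then show "\<exists>F::'a set set. countable F \<and> F \<subseteq> sets lebesgue \<and> \<Union>F = space lebesgue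
        \<and> (\<forall>a\<in>F. emeasure lebesgue a \<noteq> \<infinity>)"
      by (intro exI[of _ F]) auto
  qed
  have si: "set_integrable lebesgue A f" if "A \<in> sets lebesgue" for A
    unfolding set_integrable_def using integrable_mult_indicator[OF that f(1)] by simp
  have sets_box: "sigma_sets UNIV (range (\<lambda>(a, b). box a b)) = (sets borel :: 'a set set)"
    unfolding borel_eq_box by (rule sets_measure_of[symmetric]) simp
  have borel_lebesgue: "A \<in> sets lebesgue" if "A \<in> sets borel" for A :: "'a set"
    using that by simp
  have borel: "set_lebesgue_integral lebesgue A f = 0" if "A \<in> sets borel" for A
  proof -
    have "Int_stable (range (\<lambda>(a, b). box a b :: 'a set))"
    proof (rule Int_stableI)
      fix X Y :: "'a set" assume "X \<in> range (\<lambda>(a, b). box a b)" "Y \<in> range (\<lambda>(a, b). box a b)"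
      then obtain a b c d where "X = box a b" "Y = box c d" by auto
      then show "X \<inter> Y \<in> range (\<lambda>(a, b). box a b)"
        using box_Int_box[of a b c d] by (auto intro!: range_eqI[of _ _ "(_, _)"])
    qed
    moreover have "range (\<lambda>(a, b). box a b :: 'a set) \<subseteq> Pow UNIV"
      by simp
    moreover have "A \<in> sigma_sets UNIV (range (\<lambda>(a, b). box a b))"
      using that unfolding sets_box .
    ultimately show ?thesis
    proof (induction rule: sigma_sets_induct_disjoint)
      case (basic A)
      then show ?case using zero by (auto simp: set_lebesgue_integral_def)
    next
      case empty
      show ?case by (simp add: set_lebesgue_integral_def)
    next
      case (compl A)
      then have A: "A \<in> sets lebesgue"
        unfolding sets_box by (intro borel_lebesgue)
      have "(\<lambda>x. indicator (UNIV - A) x *\<^sub>R f x) = (\<lambda>x. f x - indicator A x *\<^sub>R f x)"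
        by (auto simp: indicator_def)
      then have "set_lebesgue_integral lebesgue (UNIV - A) f = (LINT x|lebesgue. f x - indicator A x *\<^sub>R f x)"
        by (simp only: set_lebesgue_integral_def)
      also have "\<dots> = (LINT x|lebesgue. f x) - set_lebesgue_integral lebesgue A f"
        unfolding set_lebesgue_integral_def
        by (rule Bochner_Integration.integral_diff[OF f(1) si[OF A, unfolded set_integrable_def]])
      finally show ?case
        using compl f(2) by simp
    next
      case (union A)
      then have A: "A i \<in> sets lebesgue" for i
        unfolding sets_box by (intro borel_lebesgue) blast
      have "set_lebesgue_integral lebesgue (\<Union>(range A)) f = (\<Sum>i. set_lebesgue_integral lebesgue (A i) f)"
        by (rule lebesgue_integral_countable_add[OF A])
           (use union A in \<open>auto simp: disjoint_family_on_def intro!: si\<close>)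
      then show ?case using union by simp
    qed
  qed
  show ?thesis
  proof (rule density_zero[OF f(1)])
    fix A :: "'a set" assume A: "A \<in> sets lebesgue"
    \<comment> \<open>Passing from Lebesgue to Borel sets costs only a null set.\<close>
    then obtain B N where B: "B \<in> sets borel" "negligible N" "B \<union> N = A"
      using sets_lebesgue_almost_borel by metis
    have "AE x in lebesgue. x \<notin> N"
      using B(2) by (simp add: negligible_iff_null_sets AE_not_in)
    then have "AE x in lebesgue. indicator A x *\<^sub>R f x = indicator B x *\<^sub>R f x"
      by eventually_elim (use B in \<open>auto simp: indicator_def\<close>)
    then have "set_lebesgue_integral lebesgue A f = set_lebesgue_integral lebesgue B f"
      unfolding set_lebesgue_integral_def
      using si[OF A] si[of B] B(1) by (intro integral_cong_AE) (auto simp: set_integrable_def)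
    then show "set_lebesgue_integral lebesgue A f = 0"
      using borel[OF B(1)] by simp
  qed
qed

text \<open>A locally integrable g need not be integrable on U, so it is cut off to one box of a
  countable cover at a time. Each cut-off is integrable on the whole space, and the countably many
  null sets are united at the end.\<close>

lemma fundamental_lemma_calculus_of_variations:
  fixes U :: "(real^'n::finite) set"
  assumes U: "open U" and g: "locally_integrable_on g U"
    and zero: "\<And>\<phi>. \<phi> \<in> test_funs U \<Longrightarrow> (LINT x|lebesgue_on U. g x * \<phi> x) = 0"
  shows "AE x in lebesgue_on U. g x = 0"
proof -
  obtain D where D: "countable D" "D \<subseteq> Pow U" "\<And>X. X \<in> D \<Longrightarrow> \<exists>a b. X = cbox a b" "\<Union>D = U"
    using open_countable_Union_open_cbox[OF U] by metis
  have "AE x in lebesgue. x \<in> X \<longrightarrow> g x = 0" if X: "X \<in> D" for X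
  proof -
    obtain p q where pq: "X = cbox p q" using D(3)[OF X] by blast
    then have pqU: "cbox p q \<subseteq> U" using X D by blast
    \<comment> \<open>Cutting off with an open box stays among open boxes: its intersection with any
      other open box is again one, and if nonempty its closure lies in U.\<close>
    define f where "f x = indicator (box p q) x * g x" for x
    have int0: "(LINT x|lebesgue. indicator (box a b) x * g x) = 0" if "cbox a b \<subseteq> U" for a b
      using locally_integrable_on_integral_box[OF U g _ that] zero by blast
    have "g absolutely_integrable_on cbox p q"
      using g pqU unfolding locally_integrable_on_def by simp
    then have "g absolutely_integrable_on box p q"
      by (rule set_integrable_subset) (auto simp: box_subset_cbox)
    then have "integrable lebesgue f"
      by (simp add: f_def[abs_def] set_integrable_def)
    moreover have "(LINT x|lebesgue. f x) = 0"
      unfolding f_def by (rule int0[OF pqU])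
    moreover have "(LINT x|lebesgue. indicator (box a b) x * f x) = 0" for a b
    proof -
      obtain c d where cd: "box a b \<inter> box p q = box c d"
        using box_Int_box by blast
      have "(\<lambda>x. indicator (box a b) x * f x) = (\<lambda>x. indicator (box c d) x * g x)"
        by (auto simp: f_def indicator_def simp flip: cd)
      moreover have "(LINT x|lebesgue. indicator (box c d) x * g x) = 0"
      proof (cases "box c d = {}")
        case False
        then have "cbox c d = closure (box c d)" "cbox p q = closure (box p q)"
          using cd by (metis Int_empty_right closure_box)+
        then have "cbox c d \<subseteq> cbox p q"
          using cd by (metis Int_lower2 closure_mono)
        then show ?thesis using int0 pqU by blast
      qed simp
      ultimately show ?thesis by (simp only:)
    qed
    ultimately have "AE x in lebesgue. f x = 0"
      by (rule AE_zero_of_box_integrals)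
    \<comment> \<open>The cut-off ignores the boundary of the closed box, which is a null
      set.\<close>
    moreover have "AE x in lebesgue. x \<notin> cbox p q - box p q"
      by (intro AE_not_in) (simp flip: negligible_iff_null_sets add: negligible_frontier_interval)
    ultimately show ?thesis
      by eventually_elim (auto simp: f_def pq indicator_def split: if_splits)
  qed
  then have "AE x in lebesgue. \<forall>X\<in>D. x \<in> X \<longrightarrow> g x = 0"
    unfolding AE_ball_countable[OF D(1)] by (rule ballI)
  then have "AE x in lebesgue. x \<in> U \<longrightarrow> g x = 0"
    by eventually_elim (use D(4) in blast)
  then show ?thesis
    using U by (simp add: AE_restrict_space_iff)
qed

text \<open>Both candidates have the same integral against each test function; its compact support
  makes the two products integrable, so the integral of the difference splits.\<close>

lemma weak_deriv_unique:
  assumes U: "open U" and g: "is_weak_deriv U \<alpha> w g" and h: "is_weak_deriv U \<alpha> w h"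
  shows "AE x in lebesgue_on U. g x = h x"
proof -
  have "AE x in lebesgue_on U. g x - h x = 0"
  proof (rule fundamental_lemma_calculus_of_variations[OF U])
    show "locally_integrable_on (\<lambda>x. g x - h x) U"
      using g h by (auto simp: is_weak_deriv_def locally_integrable_on_def)
    fix \<phi> assume \<phi>: "\<phi> \<in> test_funs U"
    have supp: "compact (closure {x. \<phi> x \<noteq> 0})" "closure {x. \<phi> x \<noteq> 0} \<subseteq> U"
      "\<And>x. x \<notin> closure {x. \<phi> x \<noteq> 0} \<Longrightarrow> \<phi> x = 0" "continuous_on UNIV \<phi>"
      using \<phi> closure_subset[of "{x. \<phi> x \<noteq> 0}"] by (auto simp: test_funs_def intro: smooth_fun_continuous_on)
    have "integrable (lebesgue_on U) (\<lambda>x. k x * \<phi> x)" if "is_weak_deriv U \<alpha> w k" for k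
    proof -
      have "locally_integrable_on k U"
        using that by (simp add: is_weak_deriv_def)
      then show ?thesis
        by (rule locally_integrable_on_mult_integrable[OF U _ supp(4,1-3)])
    qed
    from this[OF g] this[OF h]
    have diff: "(LINT x|lebesgue_on U. (g x - h x) * \<phi> x)
        = (LINT x|lebesgue_on U. g x * \<phi> x) - (LINT x|lebesgue_on U. h x * \<phi> x)"
      unfolding left_diff_distrib by (rule Bochner_Integration.integral_diff)
    have weak: "(LINT x|lebesgue_on U. w x * mi_partial \<alpha> \<phi> x)
        = (- 1) ^ mi_order \<alpha> * (LINT x|lebesgue_on U. k x * \<phi> x)" if "is_weak_deriv U \<alpha> w k" for k
      using that \<phi> unfolding is_weak_deriv_def by blast
    have "(- 1) ^ mi_order \<alpha> * (LINT x|lebesgue_on U. g x * \<phi> x)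
        = (- 1) ^ mi_order \<alpha> * (LINT x|lebesgue_on U. h x * \<phi> x)"
      by (rule trans[OF weak[OF g, symmetric] weak[OF h]])
    then show "(LINT x|lebesgue_on U. (g x - h x) * \<phi> x) = 0"
      by (simp add: diff)
  qed
  then show ?thesis by simp
qed

section \<open>Weak derivatives and Lebesgue norms under affine maps\<close>

text \<open>Keeps the derivatives of a test function inside its support; W is open because a
  derivative depends on the values nearby.\<close>

lemma iter_partial_eq_0:
  assumes "open W" "\<And>x. x \<in> W \<Longrightarrow> f x = 0" "x \<in> W"
  shows "iter_partial is f x = 0"
  using assms(3)
proof (induction "is" arbitrary: x)
  case (Cons i "is")
  have "((\<lambda>_. 0) has_derivative (\<lambda>_. 0)) (at x)" by simp
  then have "(iter_partial is f has_derivative (\<lambda>_. 0)) (at x)"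
    by (rule has_derivative_transform_within_open[OF _ assms(1) Cons.prems]) (simp add: Cons.IH)
  then show ?case
    by (simp add: partial_derivI)
qed (simp add: assms)

lemma mi_partial_eq_iter_partial:
  assumes "smooth_fun f" "count_list js = \<alpha>"
  shows "mi_partial \<alpha> f = iter_partial js f"
proof -
  have "\<exists>is. \<forall>i. count_list is i = \<alpha> i"
    using assms(2) by auto
  from someI_ex[OF this] have "count_list (SOME is. \<forall>i. count_list is i = \<alpha> i) = count_list js"
    using assms(2) by auto
  then show ?thesis
    unfolding mi_partial_def by (rule iter_partial_cong_count[OF assms(1)])
qed

lemma test_fun_smooth: "\<phi> \<in> test_funs U \<Longrightarrow> smooth_fun \<phi>"
  by (simp add: test_funs_def)

lemma integrable_mult_iter_partial_test_fun:
  assumes U: "open U" and g: "locally_integrable_on g U" and \<phi>: "\<phi> \<in> test_funs U"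
  shows "integrable (lebesgue_on U) (\<lambda>x. g x * iter_partial is \<phi> x)"
proof (rule locally_integrable_on_mult_integrable[OF U g])
  let ?K = "closure {x. \<phi> x \<noteq> 0}"
  show "continuous_on UNIV (iter_partial is \<phi>)"
    by (intro smooth_fun_continuous_on smooth_fun_iter_partial test_fun_smooth[OF \<phi>])
  show "compact ?K" "?K \<subseteq> U"
    using \<phi> by (simp_all add: test_funs_def)
  fix x assume "x \<notin> ?K"
  then show "iter_partial is \<phi> x = 0"
    using closure_subset[of "{x. \<phi> x \<noteq> 0}"] by (intro iter_partial_eq_0[of "- ?K"]) auto
qed

lemma vimage_aff_map_compact:
  assumes "det A \<noteq> 0" "compact K"
  shows "compact (aff_map A c -` K)"
  unfolding vimage_aff_map[OF assms(1)]
  by (rule compact_continuous_image[OF continuous_on_aff_map assms(2)])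

lemma vimage_aff_map_open: "open V \<Longrightarrow> open (aff_map A c -` V)"
  by (simp add: open_vimage continuous_on_aff_map)

text \<open>An affine bijection pulls the compact support back to a compact set, which contains the
  support of the composition.\<close>

lemma test_fun_aff_map:
  assumes det: "det A \<noteq> 0" and \<phi>: "\<phi> \<in> test_funs U"
  shows "(\<lambda>x. \<phi> (aff_map A c x)) \<in> test_funs (aff_map A c -` U)"
proof -
  let ?K = "closure {x. \<phi> x \<noteq> 0}"
  have K: "compact ?K" "?K \<subseteq> U"
    using \<phi> by (simp_all add: test_funs_def)
  have "compact (aff_map A c -` ?K)"
    by (rule vimage_aff_map_compact[OF det K(1)])
  moreover have sub: "closure {x. \<phi> (aff_map A c x) \<noteq> 0} \<subseteq> aff_map A c -` ?K"
    using closure_subset[of "{x. \<phi> x \<noteq> 0}"]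
    by (intro closure_minimal compact_imp_closed calculation) auto
  ultimately have "compact (closure {x. \<phi> (aff_map A c x) \<noteq> 0})"
    by (meson bounded_subset closed_closure compact_eq_bounded_closed)
  then show ?thesis
    using sub K(2) smooth_fun_aff_map[OF test_fun_smooth[OF \<phi>]] by (auto simp: test_funs_def)
qed

lemma locally_integrable_on_aff_map:
  assumes det: "det A \<noteq> 0" and g: "locally_integrable_on g V"
  shows "locally_integrable_on (\<lambda>x. g (aff_map A c x)) (aff_map A c -` V)"
  unfolding locally_integrable_on_def
proof (intro allI impI)
  fix K assume K: "compact K \<and> K \<subseteq> aff_map A c -` V"
  \<comment> \<open>The change of variables is stated for preimages, so K is written as the preimage
    of its compact image.\<close>
  let ?L = "aff_map A c ` K"
  have L: "compact ?L" "?L \<subseteq> V"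
    using K continuous_on_aff_map compact_continuous_image by blast+
  have lebesgue: "S \<in> sets lebesgue" if "compact S" for S :: "(real^'a) set"
    using that by (simp add: borel_compact)
  have "inj (aff_map A c)"
    by (rule inj_on_inverseI) (rule aff_map_inverse(1)[OF det])
  then have KL: "aff_map A c -` ?L = K"
    by (rule inj_vimage_image_eq)
  have "g absolutely_integrable_on ?L"
    using g L unfolding locally_integrable_on_def by blast
  then have "integrable (lebesgue_on ?L) g"
    using integrable_lebesgue_on_iff lebesgue L(1) by blast
  from integrable_aff_map[OF det lebesgue[OF L(1)] this, of c, unfolded KL]
  show "(\<lambda>x. g (aff_map A c x)) absolutely_integrable_on K"
    using integrable_lebesgue_on_iff lebesgue K by blast
qed

lemma locally_integrable_on_sum:
  assumes "\<And>i. i \<in> I \<Longrightarrow> locally_integrable_on (g i) U"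
  shows "locally_integrable_on (\<lambda>x. \<Sum>i\<in>I. a i * g i x) U"
  unfolding locally_integrable_on_def
proof (intro allI impI)
  fix K assume K: "compact K \<and> K \<subseteq> U"
  then have Kl: "K \<in> sets lebesgue"
    by (simp add: borel_compact)
  have "integrable (lebesgue_on K) (g i)" if "i \<in> I" for i
    using assms[OF that] K unfolding locally_integrable_on_def integrable_lebesgue_on_iff[OF Kl] by blast
  then have "integrable (lebesgue_on K) (\<lambda>x. \<Sum>i\<in>I. a i * g i x)"
    by (intro Bochner_Integration.integrable_sum Bochner_Integration.integrable_mult_right)
  then show "(\<lambda>x. \<Sum>i\<in>I. a i * g i x) absolutely_integrable_on K"
    unfolding integrable_lebesgue_on_iff[OF Kl] .
qed

text \<open>The substitution is made once in each direction, so the determinant cancels. The family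
  g is indexed by lists so that the result matches the chain rule of the test function term by
  term.\<close>

lemma is_weak_deriv_aff_map:
  fixes A :: "real^'n::finite^'n"
  assumes det: "det A \<noteq> 0" and V: "open V"
    and weak: "\<And>is. length is = mi_order \<alpha> \<Longrightarrow> is_weak_deriv V (count_list is) w (g is)"
    and js: "count_list js = \<alpha>"
  shows "is_weak_deriv (aff_map A c -` V) \<alpha> (\<lambda>x. w (aff_map A c x))
    (\<lambda>x. \<Sum>is | length is = mi_order \<alpha>. chain_coeff A is js * g is (aff_map A c x))"
    (is "is_weak_deriv ?U \<alpha> _ _")
  unfolding is_weak_deriv_def
proof (intro conjI ballI)
  let ?L = "{is :: 'n list. length is = mi_order \<alpha>}"
  have len: "length js = mi_order \<alpha>"
    using js mi_order_count_list by metis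
  have Vl: "V \<in> sets lebesgue"
    using V by simp
  have loc: "locally_integrable_on w V" "\<And>is. is \<in> ?L \<Longrightarrow> locally_integrable_on (g is) V"
    using weak len unfolding is_weak_deriv_def by blast+
  show "locally_integrable_on (\<lambda>x. w (aff_map A c x)) ?U"
    by (rule locally_integrable_on_aff_map[OF det loc(1)])
  show "locally_integrable_on (\<lambda>x. \<Sum>is\<in>?L. chain_coeff A is js * g is (aff_map A c x)) ?U"
    by (intro locally_integrable_on_sum locally_integrable_on_aff_map[OF det loc(2)])
  fix \<phi> assume \<phi>: "\<phi> \<in> test_funs ?U"
  define F where "F = aff_map A c"
  define \<psi> where "\<psi> = (\<lambda>y. \<phi> (aff_map (matrix_inv A) (- (matrix_inv A *v c)) y))"
  have "aff_map (matrix_inv A) (- (matrix_inv A *v c)) -` ?U = V"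
    by (auto simp: aff_map_inverse[OF det])
  then have \<psi>: "\<psi> \<in> test_funs V"
    using test_fun_aff_map[OF det_matrix_inv_nz[OF det] \<phi>] unfolding \<psi>_def by metis
  have \<phi>_eq: "\<phi> = (\<lambda>x. \<psi> (F x))"
    by (simp add: \<psi>_def F_def aff_map_inverse[OF det])
  have D: "mi_partial \<alpha> \<phi> x = (\<Sum>is\<in>?L. chain_coeff A is js * iter_partial is \<psi> (F x))" for x
    unfolding mi_partial_eq_iter_partial[OF test_fun_smooth[OF \<phi>] js]
    unfolding \<phi>_eq F_def iter_partial_aff_map[OF test_fun_smooth[OF \<psi>]] len ..
  have int_w: "integrable (lebesgue_on V) (\<lambda>y. chain_coeff A is js * (w y * iter_partial is \<psi> y))" for "is"
    by (intro Bochner_Integration.integrable_mult_right integrable_mult_iter_partial_test_fun V loc(1) \<psi>)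
  have int_g: "integrable (lebesgue_on V) (\<lambda>y. chain_coeff A is js * (g is y * \<psi> y))" if "is \<in> ?L" for "is"
    using integrable_mult_iter_partial_test_fun[OF V loc(2)[OF that] \<psi>, of "[]"] by simp
  have "(LINT x|lebesgue_on ?U. w (F x) * mi_partial \<alpha> \<phi> x)
      = (LINT x|lebesgue_on ?U. (\<lambda>y. \<Sum>is\<in>?L. chain_coeff A is js * (w y * iter_partial is \<psi> y)) (F x))"
    unfolding D sum_distrib_left by (simp add: mult_ac)
  also have "\<dots> = (LINT y|lebesgue_on V. (\<Sum>is\<in>?L. chain_coeff A is js * (w y * iter_partial is \<psi> y))) / \<bar>det A\<bar>"
    unfolding F_def
    by (rule integral_aff_map[OF det Vl borel_measurable_integrable[OF Bochner_Integration.integrable_sum[OF int_w]]])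
  also have "(LINT y|lebesgue_on V. (\<Sum>is\<in>?L. chain_coeff A is js * (w y * iter_partial is \<psi> y)))
      = (\<Sum>is\<in>?L. chain_coeff A is js * (LINT y|lebesgue_on V. w y * iter_partial is \<psi> y))"
    using int_w by simp
  also have "\<dots> = (\<Sum>is\<in>?L. chain_coeff A is js * ((- 1) ^ mi_order \<alpha> * (LINT y|lebesgue_on V. g is y * \<psi> y)))"
  proof (rule sum.cong[OF refl])
    fix "is" assume "is": "is \<in> ?L"
    then have "is_weak_deriv V (count_list is) w (g is)"
      using weak by simp
    then have "(LINT y|lebesgue_on V. w y * mi_partial (count_list is) \<psi> y)
        = (- 1) ^ mi_order (count_list is) * (LINT y|lebesgue_on V. g is y * \<psi> y)"
      using \<psi> unfolding is_weak_deriv_def by blast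
    then show "chain_coeff A is js * (LINT y|lebesgue_on V. w y * iter_partial is \<psi> y)
        = chain_coeff A is js * ((- 1) ^ mi_order \<alpha> * (LINT y|lebesgue_on V. g is y * \<psi> y))"
      using "is" by (simp add: mi_partial_eq_iter_partial[OF test_fun_smooth[OF \<psi>] refl] mi_order_count_list)
  qed
  \<comment> \<open>All lists in the sum have the same length, so their signs agree and factor
    out.\<close>
  also have "\<dots> = (- 1) ^ mi_order \<alpha> * (\<Sum>is\<in>?L. chain_coeff A is js * (LINT y|lebesgue_on V. g is y * \<psi> y))"
    by (simp add: sum_distrib_left mult_ac)
  also have "(\<Sum>is\<in>?L. chain_coeff A is js * (LINT y|lebesgue_on V. g is y * \<psi> y))
      = (LINT y|lebesgue_on V. (\<Sum>is\<in>?L. chain_coeff A is js * (g is y * \<psi> y)))"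
    by (subst Bochner_Integration.integral_sum[OF int_g]) simp_all
  also have "(- 1) ^ mi_order \<alpha> * \<dots> / \<bar>det A\<bar> = (- 1) ^ mi_order \<alpha> *
      (LINT x|lebesgue_on ?U. (\<lambda>y. \<Sum>is\<in>?L. chain_coeff A is js * (g is y * \<psi> y)) (F x))"
    unfolding F_def
    by (subst integral_aff_map[OF det Vl borel_measurable_integrable[OF Bochner_Integration.integrable_sum[OF int_g]]]) simp_all
  also have "(LINT x|lebesgue_on ?U. (\<lambda>y. \<Sum>is\<in>?L. chain_coeff A is js * (g is y * \<psi> y)) (F x))
      = (LINT x|lebesgue_on ?U. (\<Sum>is\<in>?L. chain_coeff A is js * g is (F x)) * \<phi> x)"
    unfolding \<phi>_eq sum_distrib_right by (simp add: mult_ac)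
  finally show "(LINT x|lebesgue_on ?U. w (aff_map A c x) * mi_partial \<alpha> \<phi> x) = (- 1) ^ mi_order \<alpha> *
      (LINT x|lebesgue_on ?U. (\<Sum>is\<in>?L. chain_coeff A is js * g is (aff_map A c x)) * \<phi> x)"
    unfolding F_def .
qed

section \<open>Lebesgue norms and the chosen representatives of weak derivatives\<close>

lemma Lp_norm_cong_AE:
  assumes "f \<in> borel_measurable (lebesgue_on U)" "g \<in> borel_measurable (lebesgue_on U)"
    and ae: "AE x in lebesgue_on U. f x = g x"
  shows "Lp_norm p U f = Lp_norm p U g"
proof -
  have ess: "esssup (lebesgue_on U) (\<lambda>x. ennreal \<bar>f x\<bar>) = esssup (lebesgue_on U) (\<lambda>x. ennreal \<bar>g x\<bar>)"
    by (rule esssup_AE_cong) (use assms in \<open>auto elim: eventually_mono\<close>)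
  have int: "(LINT x|lebesgue_on U. \<bar>f x\<bar> powr r) = (LINT x|lebesgue_on U. \<bar>g x\<bar> powr r)" for r
    by (rule integral_cong_AE) (use assms in \<open>auto elim: eventually_mono\<close>)
  show ?thesis
    unfolding Lp_norm_def ess int ..
qed

lemma Lp_space_cong_AE:
  assumes f: "f \<in> Lp_space p U" and g: "g \<in> borel_measurable (lebesgue_on U)"
    and ae: "AE x in lebesgue_on U. f x = g x"
  shows "g \<in> Lp_space p U"
proof -
  have f': "f \<in> borel_measurable (lebesgue_on U)"
    using f by (simp add: Lp_space_def)
  have ess: "esssup (lebesgue_on U) (\<lambda>x. ennreal \<bar>f x\<bar>) = esssup (lebesgue_on U) (\<lambda>x. ennreal \<bar>g x\<bar>)"
    by (rule esssup_AE_cong) (use f' g ae in \<open>auto elim: eventually_mono\<close>)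
  have int: "integrable (lebesgue_on U) (\<lambda>x. \<bar>f x\<bar> powr r) = integrable (lebesgue_on U) (\<lambda>x. \<bar>g x\<bar> powr r)" for r
    by (rule integrable_cong_AE) (use f' g ae in \<open>auto elim: eventually_mono\<close>)
  show ?thesis
    using f g unfolding Lp_space_def mem_Collect_eq ess[symmetric] int[symmetric] by blast
qed

text \<open>The Sobolev space only asks for some weak derivative in the Lebesgue space; uniqueness
  hands this on to the one that \<open>weak_deriv\<close> chooses.\<close>

lemma sobolev_space_weak_deriv:
  assumes U: "open U" and w: "w \<in> sobolev_space l p U" and \<alpha>: "mi_order \<alpha> \<le> l"
  shows "is_weak_deriv U \<alpha> w (weak_deriv U \<alpha> w)" "weak_deriv U \<alpha> w \<in> Lp_space p U"
proof -
  obtain g where g: "g \<in> Lp_space p U" "is_weak_deriv U \<alpha> w g"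
    using w \<alpha> unfolding sobolev_space_def by blast
  from g(2) show weak: "is_weak_deriv U \<alpha> w (weak_deriv U \<alpha> w)"
    unfolding weak_deriv_def by (rule someI[of "is_weak_deriv U \<alpha> w"])
  then have "weak_deriv U \<alpha> w \<in> borel_measurable (lebesgue_on U)"
    by (intro locally_integrable_on_measurable[OF U]) (simp add: is_weak_deriv_def)
  then show "weak_deriv U \<alpha> w \<in> Lp_space p U"
    by (rule Lp_space_cong_AE[OF g(1) _ weak_deriv_unique[OF U g(2) weak]])
qed

text \<open>Trades the opaque choice in the seminorm for an explicit weak derivative.\<close>

lemma Lp_norm_weak_deriv:
  assumes U: "open U" and g: "is_weak_deriv U \<alpha> w g"
  shows "Lp_norm p U (weak_deriv U \<alpha> w) = Lp_norm p U g"
proof -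
  have weak: "is_weak_deriv U \<alpha> w (weak_deriv U \<alpha> w)"
    unfolding weak_deriv_def using g by (rule someI[of "is_weak_deriv U \<alpha> w"])
  have meas: "k \<in> borel_measurable (lebesgue_on U)" if "is_weak_deriv U \<alpha> w k" for k
    using that by (intro locally_integrable_on_measurable[OF U]) (simp add: is_weak_deriv_def)
  show ?thesis
    by (rule Lp_norm_cong_AE[OF meas[OF weak] meas[OF g] weak_deriv_unique[OF U weak g]])
qed

lemma Lp_space_infinity_AE:
  assumes "f \<in> Lp_space \<infinity> U"
  shows "AE x in lebesgue_on U. \<bar>f x\<bar> \<le> Lp_norm \<infinity> U f"
proof -
  have fin: "esssup (lebesgue_on U) (\<lambda>x. ennreal \<bar>f x\<bar>) < \<infinity>"
    using assms by (simp add: Lp_space_def)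
  show ?thesis
    using esssup_AE[of "\<lambda>x. ennreal \<bar>f x\<bar>" "lebesgue_on U"]
  proof eventually_elim
    case (elim x)
    then have "enn2real (ennreal \<bar>f x\<bar>) \<le> enn2real (esssup (lebesgue_on U) (\<lambda>x. ennreal \<bar>f x\<bar>))"
      using fin by (intro enn2real_mono) simp_all
    then show ?case by (simp add: Lp_norm_def)
  qed
qed

lemma Lp_norm_infinity_le:
  assumes f: "f \<in> borel_measurable (lebesgue_on U)" and K: "0 \<le> K"
    and ae: "AE x in lebesgue_on U. \<bar>f x\<bar> \<le> K"
  shows "f \<in> Lp_space \<infinity> U" "Lp_norm \<infinity> U f \<le> K"
proof -
  have le: "esssup (lebesgue_on U) (\<lambda>x. ennreal \<bar>f x\<bar>) \<le> ennreal K"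
    by (rule esssup_I) (use f ae K in \<open>auto elim: eventually_mono\<close>)
  then show "f \<in> Lp_space \<infinity> U"
    using f by (auto simp: Lp_space_def intro: le_less_trans)
  show "Lp_norm \<infinity> U f \<le> K"
    using enn2real_mono[OF le] K by (simp add: Lp_norm_def)
qed

lemma Lp_norm_nonneg: "0 \<le> Lp_norm p U f"
  by (simp add: Lp_norm_def)

text \<open>The sum is at most card I times its largest term, whose q-th power is among those on the
  right. For q >= 1 convexity would save one power of card I; the crude form becomes the plain
  factor card I after a q-th root.\<close>

lemma powr_sum_le:
  fixes a :: "'i \<Rightarrow> real"
  assumes I: "finite I" and a: "\<And>i. i \<in> I \<Longrightarrow> 0 \<le> a i" and q: "0 \<le> q"
  shows "(\<Sum>i\<in>I. a i) powr q \<le> real (card I) powr q * (\<Sum>i\<in>I. a i powr q)"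
proof (cases "I = {}")
  case False
  define m where "m = Max (a ` I)"
  have "m \<in> a ` I"
    unfolding m_def using I False by (intro Max_in) auto
  then obtain k where k: "k \<in> I" "m = a k" by blast
  have "(\<Sum>i\<in>I. a i) \<le> (\<Sum>i\<in>I. m)"
    unfolding m_def using I by (intro sum_mono) simp
  then have "(\<Sum>i\<in>I. a i) \<le> real (card I) * m" by simp
  then have "(\<Sum>i\<in>I. a i) powr q \<le> (real (card I) * m) powr q"
    using a by (intro powr_mono2 q sum_nonneg)
  also have "\<dots> = real (card I) powr q * a k powr q"
    using k a by (simp add: powr_mult)
  also have "\<dots> \<le> real (card I) powr q * (\<Sum>i\<in>I. a i powr q)"
    using k I by (intro mult_left_mono member_le_sum) auto
  finally show ?thesis .
qed simp

section \<open>Linear combinations of functions composed with an affine map\<close>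

context
  fixes A :: "real^'n::finite^'n" and c :: "real^'n" and V :: "(real^'n) set"
    and I :: "'i set" and a :: "'i \<Rightarrow> real" and B :: real and v :: "'i \<Rightarrow> real^'n \<Rightarrow> real"
  assumes det: "det A \<noteq> 0" and V: "V \<in> sets lebesgue"
    and I: "finite I" and a: "\<And>i. i \<in> I \<Longrightarrow> \<bar>a i\<bar> \<le> B" and B: "0 \<le> B"
begin

abbreviation (input) "lincomb x \<equiv> \<Sum>i\<in>I. a i * v i (aff_map A c x)"

lemma abs_lincomb_le: "\<bar>lincomb x\<bar> \<le> B * (\<Sum>i\<in>I. \<bar>v i (aff_map A c x)\<bar>)"
proof -
  have "\<bar>lincomb x\<bar> \<le> (\<Sum>i\<in>I. \<bar>a i * v i (aff_map A c x)\<bar>)"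
    by (rule sum_abs)
  also have "\<dots> \<le> (\<Sum>i\<in>I. B * \<bar>v i (aff_map A c x)\<bar>)"
    unfolding abs_mult by (intro sum_mono mult_right_mono a) simp_all
  finally show ?thesis by (simp add: sum_distrib_left)
qed

lemma borel_measurable_lincomb:
  assumes "\<And>i. i \<in> I \<Longrightarrow> v i \<in> borel_measurable (lebesgue_on V)"
  shows "lincomb \<in> borel_measurable (lebesgue_on (aff_map A c -` V))"
  by (intro borel_measurable_sum borel_measurable_times borel_measurable_const
      borel_measurable_aff_map[OF det V] assms)

text \<open>The v i share one bound S because the seminorm for p = \<infinity> is a maximum;
  finiteness of I lets the exceptional null sets be united.\<close>

lemma Lp_space_lincomb_infinity:
  assumes v: "\<And>i. i \<in> I \<Longrightarrow> v i \<in> Lp_space \<infinity> V" "\<And>i. i \<in> I \<Longrightarrow> Lp_norm \<infinity> V (v i) \<le> S" and S: "0 \<le> S"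
  shows "lincomb \<in> Lp_space \<infinity> (aff_map A c -` V)"
    and "Lp_norm \<infinity> (aff_map A c -` V) lincomb \<le> real (card I) * B * S"
proof -
  have "AE y in lebesgue_on V. \<bar>v i y\<bar> \<le> S" if "i \<in> I" for i
    using Lp_space_infinity_AE[OF v(1)[OF that]] v(2)[OF that] by (auto elim: eventually_mono)
  then have "AE y in lebesgue_on V. \<forall>i\<in>I. \<bar>v i y\<bar> \<le> S"
    unfolding AE_finite_all[OF I] by (rule ballI)
  from AE_aff_map[OF det V this, of c]
  have ae: "AE x in lebesgue_on (aff_map A c -` V). \<bar>lincomb x\<bar> \<le> real (card I) * B * S"
  proof eventually_elim
    case (elim x)
    have "(\<Sum>i\<in>I. \<bar>v i (aff_map A c x)\<bar>) \<le> real (card I) * S"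
      using sum_bounded_above[of I "\<lambda>i. \<bar>v i (aff_map A c x)\<bar>" S] elim by simp
    from mult_left_mono[OF this B] abs_lincomb_le[of x]
    show ?case by (simp add: mult_ac)
  qed
  have "lincomb \<in> borel_measurable (lebesgue_on (aff_map A c -` V))"
    using v(1) by (intro borel_measurable_lincomb) (simp add: Lp_space_def)
  from Lp_norm_infinity_le[OF this _ ae] B S
  show "lincomb \<in> Lp_space \<infinity> (aff_map A c -` V)"
    "Lp_norm \<infinity> (aff_map A c -` V) lincomb \<le> real (card I) * B * S" by simp_all
qed

lemma integrable_lincomb_powr:
  assumes q: "0 \<le> q" and meas: "\<And>i. i \<in> I \<Longrightarrow> v i \<in> borel_measurable (lebesgue_on V)"
    and int: "\<And>i. i \<in> I \<Longrightarrow> integrable (lebesgue_on V) (\<lambda>y. \<bar>v i y\<bar> powr q)"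
  shows "integrable (lebesgue_on (aff_map A c -` V)) (\<lambda>x. \<bar>lincomb x\<bar> powr q)"
    and "(LINT x|lebesgue_on (aff_map A c -` V). \<bar>lincomb x\<bar> powr q)
      \<le> (real (card I) * B) powr q / \<bar>det A\<bar> * (\<Sum>i\<in>I. LINT y|lebesgue_on V. \<bar>v i y\<bar> powr q)"
proof -
  let ?U = "aff_map A c -` V"
  \<comment> \<open>A majorant on V rather than on the preimage, so that the change of variables
    supplies both integrability and the integral of its composition with the affine map.\<close>
  define H where "H = (\<lambda>y. (real (card I) * B) powr q * (\<Sum>i\<in>I. \<bar>v i y\<bar> powr q))"
  have le: "\<bar>lincomb x\<bar> powr q \<le> H (aff_map A c x)" for x
  proof -
    have "\<bar>lincomb x\<bar> powr q \<le> (B * (\<Sum>i\<in>I. \<bar>v i (aff_map A c x)\<bar>)) powr q"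
      by (intro powr_mono2 q abs_lincomb_le) simp
    also have "\<dots> = B powr q * (\<Sum>i\<in>I. \<bar>v i (aff_map A c x)\<bar>) powr q"
      using B by (simp add: powr_mult sum_nonneg)
    also have "\<dots> \<le> B powr q * (real (card I) powr q * (\<Sum>i\<in>I. \<bar>v i (aff_map A c x)\<bar> powr q))"
      by (intro mult_left_mono powr_sum_le I q) simp_all
    finally show ?thesis
      using B by (simp add: H_def powr_mult mult_ac)
  qed
  have intH: "integrable (lebesgue_on V) H"
    unfolding H_def by (intro Bochner_Integration.integrable_mult_right Bochner_Integration.integrable_sum int)
  note intHF = integrable_aff_map[OF det V intH, of c]
  have "lincomb \<in> borel_measurable (lebesgue_on ?U)"
    by (rule borel_measurable_lincomb[OF meas])
  then have "(\<lambda>x. \<bar>lincomb x\<bar> powr q) \<in> borel_measurable (lebesgue_on ?U)"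
    by (intro powr_real_measurable borel_measurable_abs borel_measurable_const)
  then show 1: "integrable (lebesgue_on ?U) (\<lambda>x. \<bar>lincomb x\<bar> powr q)"
    by (rule Bochner_Integration.integrable_bound[OF intHF])
       (intro AE_I2, use le in \<open>fastforce intro: order_trans[OF _ abs_ge_self]\<close>)
  have "(LINT x|lebesgue_on ?U. \<bar>lincomb x\<bar> powr q) \<le> (LINT x|lebesgue_on ?U. H (aff_map A c x))"
    by (rule integral_mono[OF 1 intHF le])
  also have "\<dots> = (LINT y|lebesgue_on V. H y) / \<bar>det A\<bar>"
    by (rule integral_aff_map[OF det V borel_measurable_integrable[OF intH]])
  also have "(LINT y|lebesgue_on V. H y) = (real (card I) * B) powr q * (\<Sum>i\<in>I. LINT y|lebesgue_on V. \<bar>v i y\<bar> powr q)"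
    unfolding H_def using int by simp
  finally show "(LINT x|lebesgue_on ?U. \<bar>lincomb x\<bar> powr q)
      \<le> (real (card I) * B) powr q / \<bar>det A\<bar> * (\<Sum>i\<in>I. LINT y|lebesgue_on V. \<bar>v i y\<bar> powr q)"
    by simp
qed

lemma Lp_space_lincomb:
  assumes v: "\<And>i. i \<in> I \<Longrightarrow> v i \<in> Lp_space p V"
  shows "lincomb \<in> Lp_space p (aff_map A c -` V)"
proof (cases "p = \<infinity>")
  case True
  show ?thesis
    unfolding True
  \<comment> \<open>Membership needs just some common bound; the sum of the norms is one.\<close>
  proof (rule Lp_space_lincomb_infinity(1)[of "\<Sum>i\<in>I. Lp_norm \<infinity> V (v i)"])
    show "Lp_norm \<infinity> V (v i) \<le> (\<Sum>i\<in>I. Lp_norm \<infinity> V (v i))" if "i \<in> I" for i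
      using that I by (intro member_le_sum Lp_norm_nonneg)
  qed (use v True in \<open>auto intro: sum_nonneg Lp_norm_nonneg\<close>)
next
  case False
  have "integrable (lebesgue_on V) (\<lambda>y. \<bar>v i y\<bar> powr enn2real p)" "v i \<in> borel_measurable (lebesgue_on V)" if "i \<in> I" for i
    using v[OF that] False by (simp_all add: Lp_space_def)
  from borel_measurable_lincomb[OF this(2)] integrable_lincomb_powr(1)[OF enn2real_nonneg this(2,1)]
  show ?thesis
    using False by (simp add: Lp_space_def)
qed

end

section \<open>The Sobolev seminorm estimate for one affine map\<close>

lemma abs_chain_coeff_le:
  fixes A :: "real^'n::finite^'n"
  assumes "length is = length js"
  shows "\<bar>chain_coeff A is js\<bar> \<le> spectral_norm A ^ length js"
  using assms
proof (induction "is" js rule: list_induct2)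
  case (Cons i "is" j js)
  have "\<bar>A $ i $ j\<bar> \<le> spectral_norm A"
    unfolding spectral_norm_def by (rule matrix_component_le_onorm)
  then have "\<bar>A $ i $ j\<bar> * \<bar>chain_coeff A is js\<bar> \<le> spectral_norm A * spectral_norm A ^ length js"
    using Cons.IH by (intro mult_mono) (auto intro: order_trans[OF abs_ge_zero])
  then show ?case
    by (simp add: chain_coeff_def abs_mult)
qed (simp add: chain_coeff_def)

lemma Lp_space_aff_map:
  assumes det: "det A \<noteq> 0" and V: "V \<in> sets lebesgue" and f: "f \<in> Lp_space p V"
  shows "(\<lambda>x. f (aff_map A c x)) \<in> Lp_space p (aff_map A c -` V)"
  using Lp_space_lincomb[OF det V, of "{()}" "\<lambda>_. 1" 1 "\<lambda>_. f" p c] f by simp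

text \<open>For finite p, one factor N = d^l is the p-th root of the N^p lost in the power of a sum
  of N terms. The other bounds N^(1/p), which arises from comparing the N lists with the sum over
  multi-indices, and the leading cardinality bounds its own p-th root. Rounding these roots up makes
  the constant independent of p; the type argument carries d.\<close>

definition chain_const :: "'n::finite itself \<Rightarrow> nat \<Rightarrow> real" where
  "chain_const _ l = real (card {\<alpha> :: 'n \<Rightarrow> nat. mi_order \<alpha> = l}) * real (CARD('n) ^ l) ^ 2"

lemma card_multi_indices_ge_1: "1 \<le> card {\<alpha> :: 'n::finite \<Rightarrow> nat. mi_order \<alpha> = l}"
  using finite_mi_order[of l] mi_order_nonempty[of l, where ?'n = 'n] by (simp add: Suc_le_eq card_gt_0_iff)

lemma chain_const_ge_1: "1 \<le> chain_const TYPE('n::finite) l"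
proof -
  have "1 \<le> real (CARD('n) ^ l) ^ 2"
    by (intro one_le_power) (simp add: Suc_le_eq)
  with card_multi_indices_ge_1[of l, where ?'n = 'n] show ?thesis
    unfolding chain_const_def by (intro mult_ge1_I) simp_all
qed

lemma chain_const_0: "chain_const TYPE('n::finite) 0 = 1"
proof -
  have "{\<alpha> :: 'n \<Rightarrow> nat. mi_order \<alpha> = 0} = {\<lambda>_. 0}"
    by (auto simp: mi_order_def)
  then show ?thesis by (simp add: chain_const_def)
qed

lemma powr_inverse_le_self: "1 \<le> x \<Longrightarrow> 1 \<le> q \<Longrightarrow> x powr (1 / q) \<le> x" for x q :: real
  using powr_mono[of "1 / q" 1 x] by simp

lemma sobolev_aff_map:
  fixes A :: "real^'n::finite^'n"
  assumes p: "1 \<le> p" and det: "det A \<noteq> 0" and V: "open V" and w: "w \<in> sobolev_space l p V"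
  shows "(\<lambda>x. w (aff_map A c x)) \<in> sobolev_space l p (aff_map A c -` V)" (is "?w' \<in> sobolev_space l p ?U")
    and "sobolev_seminorm l p (aff_map A c -` V) (\<lambda>x. w (aff_map A c x))
      \<le> chain_const TYPE('n) l * spectral_norm A ^ l * \<bar>det A\<bar> powr (- enn2real (1 / p))
        * sobolev_seminorm l p V w"
proof -
  have U: "open ?U" and Vl: "V \<in> sets lebesgue"
    using V by (simp_all add: vimage_aff_map_open)
  define v where "v = (\<lambda>is. weak_deriv V (count_list is) w)"
  have "\<exists>js. count_list js = \<alpha>" for \<alpha> :: "'n \<Rightarrow> nat"
    using exists_count_list[of \<alpha>] by auto
  then obtain js :: "('n \<Rightarrow> nat) \<Rightarrow> 'n list" where js: "\<And>\<alpha>. count_list (js \<alpha>) = \<alpha>"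
    by metis
  have len: "length (js \<alpha>) = mi_order \<alpha>" for \<alpha>
    using mi_order_count_list[of "js \<alpha>"] js by simp
  define L where "L = (\<lambda>m. {is :: 'n list. length is = m})"
  have finL: "finite (L m)" and cardL: "card (L m) = CARD('n) ^ m" for m
    using finite_lists_length[of m, where ?'n = 'n] card_lists_length_eq[of "UNIV :: 'n set" m] by (simp_all add: L_def)
  \<comment> \<open>The explicit weak derivatives of the composition; \<open>js \<alpha>\<close> is
    an arbitrary ordering of \<alpha>.\<close>
  define G where "G = (\<lambda>\<alpha> x. \<Sum>is\<in>L (mi_order \<alpha>). chain_coeff A is (js \<alpha>) * v is (aff_map A c x))"
  define s where "s = spectral_norm A"
  have s: "0 \<le> s"
    unfolding s_def spectral_norm_def by (rule onorm_pos_le) simp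
  have coeff: "\<bar>chain_coeff A is (js \<alpha>)\<bar> \<le> s ^ mi_order \<alpha>" if "is \<in> L (mi_order \<alpha>)" for \<alpha> "is"
    using abs_chain_coeff_le[of "is" "js \<alpha>" A] that by (simp add: L_def len s_def)
  have v: "is_weak_deriv V (count_list is) w (v is)" "v is \<in> Lp_space p V" if "is \<in> L m" "m \<le> l" for "is" m
    using sobolev_space_weak_deriv[OF V w, of "count_list is"] that by (simp_all add: v_def L_def mi_order_count_list)
  have G_weak: "is_weak_deriv ?U \<alpha> ?w' (G \<alpha>)" if "mi_order \<alpha> \<le> l" for \<alpha>
    unfolding G_def L_def
    by (rule is_weak_deriv_aff_map[OF det V v(1)[OF _ that] js]) (simp add: L_def)
  have G_Lp: "G \<alpha> \<in> Lp_space p ?U" if "mi_order \<alpha> \<le> l" for \<alpha>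
    unfolding G_def by (rule Lp_space_lincomb[OF det Vl finL coeff _ v(2)[OF _ that]]) (simp_all add: s)
  have "w \<in> Lp_space p V"
    using w by (simp add: sobolev_space_def)
  from Lp_space_aff_map[OF det Vl this] G_weak G_Lp
  show "?w' \<in> sobolev_space l p ?U"
    unfolding sobolev_space_def by blast
  let ?MI = "{\<alpha> :: 'n \<Rightarrow> nat. mi_order \<alpha> = l}"
  define M where "M = real (card ?MI)"
  define N where "N = real (CARD('n) ^ l)"
  have M: "1 \<le> M"
    unfolding M_def using card_multi_indices_ge_1[of l, where ?'n = 'n] by simp
  have N: "1 \<le> N"
    unfolding N_def by (simp add: Suc_le_eq)
  have C: "chain_const TYPE('n) l = M * N ^ 2"
    by (simp add: chain_const_def M_def N_def)
  have norm_G: "Lp_norm p ?U (weak_deriv ?U \<alpha> ?w') = Lp_norm p ?U (G \<alpha>)" if "\<alpha> \<in> ?MI" for \<alpha>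
    using Lp_norm_weak_deriv[OF U G_weak] that by simp
  have count: "count_list is \<in> ?MI" if "is \<in> L l" for "is"
    using that by (simp add: L_def mi_order_count_list)
  show "sobolev_seminorm l p ?U ?w' \<le> chain_const TYPE('n) l * spectral_norm A ^ l
      * \<bar>det A\<bar> powr (- enn2real (1 / p)) * sobolev_seminorm l p V w"
  proof (cases "p = \<infinity>")
    case True
    define S where "S = sobolev_seminorm l p V w"
    have S_ge: "Lp_norm \<infinity> V (weak_deriv V \<alpha> w) \<le> S" if "\<alpha> \<in> ?MI" for \<alpha>
      unfolding S_def sobolev_seminorm_def using that finite_mi_order[of l, where ?'n = 'n] True
      by (simp add: Max_ge)
    obtain \<alpha>0 :: "'n \<Rightarrow> nat" where "\<alpha>0 \<in> ?MI"
      using mi_order_nonempty by blast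
    then have S0: "0 \<le> S"
      using S_ge Lp_norm_nonneg order_trans by blast
    have "Lp_norm \<infinity> ?U (weak_deriv ?U \<alpha> ?w') \<le> N * s ^ l * S" if \<alpha>: "\<alpha> \<in> ?MI" for \<alpha>
    proof -
      have m: "mi_order \<alpha> = l" using \<alpha> by simp
      have "Lp_norm \<infinity> ?U (G \<alpha>) \<le> real (card (L l)) * s ^ l * S"
        unfolding G_def m
      proof (rule Lp_space_lincomb_infinity(2)[OF det Vl finL])
        fix "is" assume "is": "is \<in> L l"
        show "\<bar>chain_coeff A is (js \<alpha>)\<bar> \<le> s ^ l"
          using coeff[of "is" \<alpha>] "is" m by simp
        show "v is \<in> Lp_space \<infinity> V"
          using v(2)[OF "is"] True by simp
        show "Lp_norm \<infinity> V (v is) \<le> S"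
          unfolding v_def by (rule S_ge[OF count[OF "is"]])
      qed (simp_all add: s S0)
      then show ?thesis
        using norm_G[OF \<alpha>] True by (simp add: cardL N_def)
    qed
    then have "sobolev_seminorm l p ?U ?w' \<le> N * s ^ l * S"
      unfolding sobolev_seminorm_def using True finite_mi_order[of l, where ?'n = 'n] mi_order_nonempty[of l, where ?'n = 'n]
      by (simp add: Max_le_iff)
    also have "\<dots> \<le> (M * N ^ 2) * s ^ l * S"
    proof (intro mult_right_mono)
      have "1 * N \<le> (M * N) * N"
        using M N by (intro mult_right_mono mult_ge1_I) simp_all
      then show "N \<le> M * N ^ 2" by (simp add: power2_eq_square mult_ac)
    qed (use s S0 in simp_all)
    \<comment> \<open>For p = \<infinity> the determinant has exponent 0. It contributes 1 because
      it is nonzero, whereas \<open>0 powr 0\<close> is 0.\<close>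
    finally show ?thesis
      using True det by (simp add: C s_def S_def)
  next
    case False
    define q where "q = enn2real p"
    have pq: "p = ennreal q"
      using False by (simp add: q_def less_top)
    have q: "1 \<le> q"
      using p unfolding pq by (metis ennreal_1 ennreal_le_iff2 not_one_le_zero)
    have inv_p: "enn2real (1 / p) = 1 / q"
      using q unfolding pq by (subst divide_ennreal[of 1 q, simplified]) simp_all
    define J where "J = (\<lambda>(U :: (real^'n) set) f. LINT x|lebesgue_on U. \<bar>f x\<bar> powr q)"
    have J0: "0 \<le> J W f" for W and f :: "real^'n \<Rightarrow> real"
      by (simp add: J_def)
    \<comment> \<open>Root and power cancel because J is nonnegative, so the seminorm is the q-th
      root of a sum of integrals.\<close>
    have norm_powr: "Lp_norm p W f powr q = J W f" for W and f :: "real^'n \<Rightarrow> real"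
      using False q J0[of W f] by (simp add: Lp_norm_def inv_p powr_powr flip: q_def) (simp add: J_def)
    define S where "S = (\<Sum>\<alpha>\<in>?MI. J V (weak_deriv V \<alpha> w))"
    have S0: "0 \<le> S"
      unfolding S_def by (intro sum_nonneg J0)
    have seminorm_V: "sobolev_seminorm l p V w = S powr (1 / q)"
      using False by (simp add: sobolev_seminorm_def S_def norm_powr inv_p flip: q_def)
    have "J ?U (weak_deriv ?U \<alpha> ?w') = J ?U (G \<alpha>)" if "\<alpha> \<in> ?MI" for \<alpha>
      unfolding norm_powr[symmetric] norm_G[OF that] ..
    then have J_G: "(\<Sum>\<alpha>\<in>?MI. J ?U (weak_deriv ?U \<alpha> ?w')) = (\<Sum>\<alpha>\<in>?MI. J ?U (G \<alpha>))"
      by (rule sum.cong[OF refl])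
    have seminorm_U: "sobolev_seminorm l p ?U ?w' = (\<Sum>\<alpha>\<in>?MI. J ?U (G \<alpha>)) powr (1 / q)"
      using False by (simp add: sobolev_seminorm_def inv_p norm_powr J_G flip: q_def)
    define D where "D = \<bar>det A\<bar>"
    have D: "0 < D" using det by (simp add: D_def)
    have "J ?U (G \<alpha>) \<le> (N * s ^ l) powr q / D * (N * S)" if \<alpha>: "\<alpha> \<in> ?MI" for \<alpha>
    proof -
      have m: "mi_order \<alpha> = l" using \<alpha> by simp
      have "J ?U (G \<alpha>) \<le> (real (card (L l)) * s ^ l) powr q / \<bar>det A\<bar> * (\<Sum>is\<in>L l. J V (v is))"
        unfolding G_def m J_def
      proof (rule integrable_lincomb_powr(2)[OF det Vl finL])
        fix "is" assume "is": "is \<in> L l"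
        show "\<bar>chain_coeff A is (js \<alpha>)\<bar> \<le> s ^ l"
          using coeff[of "is" \<alpha>] "is" m by simp
        show "v is \<in> borel_measurable (lebesgue_on V)" "integrable (lebesgue_on V) (\<lambda>y. \<bar>v is y\<bar> powr q)"
          using v(2)[OF "is"] False by (simp_all add: Lp_space_def q_def)
      qed (use s q in simp_all)
      \<comment> \<open>Different lists can have the same multi-index, so each term is compared with
        the whole of S; this costs a factor N.\<close>
      also have "(\<Sum>is\<in>L l. J V (v is)) \<le> (\<Sum>is\<in>L l. S)"
        unfolding S_def v_def using count finite_mi_order[of l, where ?'n = 'n]
        by (intro sum_mono member_le_sum J0)
      finally show ?thesis
        using D by (simp add: cardL N_def D_def divide_right_mono mult_left_mono)
    qed
    then have "(\<Sum>\<alpha>\<in>?MI. J ?U (G \<alpha>)) \<le> M * ((N * s ^ l) powr q / D * (N * S))"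
      unfolding M_def by (rule sum_bounded_above)
    then have "sobolev_seminorm l p ?U ?w' \<le> (M * ((N * s ^ l) powr q / D * (N * S))) powr (1 / q)"
      unfolding seminorm_U using q by (intro powr_mono2 sum_nonneg J0) simp_all
    \<comment> \<open>The root undoes the power of N s^l and turns 1/D into D^(-1/q); M and the
      second N keep their roots until the next step.\<close>
    also have "\<dots> = M powr (1 / q) * N powr (1 / q) * (N * s ^ l * D powr (- (1 / q)) * S powr (1 / q))"
      using M N s D S0 q
      by (simp add: powr_mult powr_divide powr_powr powr_minus field_simps)
    also have "\<dots> \<le> M * N * (N * s ^ l * D powr (- (1 / q)) * S powr (1 / q))"
      using M N s q by (intro mult_right_mono mult_mono powr_inverse_le_self) simp_all
    finally show ?thesis
      by (simp add: C s_def seminorm_V inv_p D_def power2_eq_square mult_ac)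
  qed
qed

section \<open>Passage to the elements of a partition\<close>

lemma interior_vimage_aff_map:
  fixes A :: "real^'n::finite^'n"
  assumes det: "det A \<noteq> 0"
  shows "aff_map A c -` interior S = interior (aff_map A c -` S)"
proof
  show "aff_map A c -` interior S \<subseteq> interior (aff_map A c -` S)"
    by (intro interior_maximal vimage_mono interior_subset vimage_aff_map_open open_interior)
  let ?W = "interior (aff_map A c -` S)"
  let ?F' = "aff_map (matrix_inv A) (- (matrix_inv A *v c))"
  \<comment> \<open>For the converse inclusion the interior is carried over by the inverse map,
    where it becomes an open subset of S.\<close>
  have "?F' -` ?W \<subseteq> ?F' -` (aff_map A c -` S)"
    by (intro vimage_mono interior_subset)
  also have "\<dots> = S"
    by (auto simp: aff_map_inverse[OF det])
  finally have "?F' -` ?W \<subseteq> interior S"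
    by (intro interior_maximal vimage_aff_map_open open_interior)
  then show "?W \<subseteq> aff_map A c -` interior S"
    by (force simp: aff_map_inverse[OF det])
qed

text \<open>C is a function of l chosen before p, the partition and w, and d enters through the
  type, so it depends on nothing else. Elements enter through their interiors because uniqueness of
  weak derivatives is a fact about open sets.\<close>

theorem lemma1:
  shows "\<exists>C :: nat \<Rightarrow> real. C 0 = 1 \<and> (\<forall>l. C l \<ge> 1 \<and>
    (\<forall>(p :: ennreal) (\<Omega> :: (real^'n::finite) set) \<T> J b T w.
       1 \<le> p \<longrightarrow> affine_partition \<Omega> \<T> J b \<longrightarrow> T \<in> \<T> \<longrightarrow>
       w \<in> sobolev_space l p (interior T) \<longrightarrow>
       (let w' = w \<circ> aff_map (J T) (b T) in
          w' \<in> sobolev_space l p (interior ref_cube) \<and>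
          sobolev_seminorm l p (interior ref_cube) w'
            \<le> C l * spectral_norm (J T) ^ l * \<bar>det (J T)\<bar> powr (- enn2real (1 / p))
                * sobolev_seminorm l p (interior T) w \<and>
          sobolev_seminorm l p (interior T) w
            \<le> C l * spectral_norm (matrix_inv (J T)) ^ l * \<bar>det (J T)\<bar> powr enn2real (1 / p)
                * sobolev_seminorm l p (interior ref_cube) w')))"
proof (intro exI[of _ "chain_const TYPE('n)"] conjI allI impI)
  show "chain_const TYPE('n) 0 = 1" "1 \<le> chain_const TYPE('n) l" for l
    by (rule chain_const_0 chain_const_ge_1)+
  fix l p J b T w and \<Omega> :: "(real^'n) set" and \<T>
  assume p: "1 \<le> p" and part: "affine_partition \<Omega> \<T> J b" and T: "T \<in> \<T>"
    and w: "w \<in> sobolev_space l p (interior T)"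
  define A c where "A = J T" and "c = b T"
  define F where "F = aff_map A c"
  define F' where "F' = aff_map (matrix_inv A) (- (matrix_inv A *v c))"
  have det: "det A \<noteq> 0" and TF: "T = F ` ref_cube"
    using part T unfolding affine_partition_def A_def c_def F_def by blast+
  note inverse = aff_map_inverse[OF det, of c, folded F_def F'_def]
  \<comment> \<open>The partition gives T as an image of the cube, while the estimate speaks of
    preimages; injectivity links the two.\<close>
  have "inj F"
    by (rule inj_on_inverseI) (rule inverse(1))
  then have "F -` T = ref_cube"
    unfolding TF by (rule inj_vimage_image_eq)
  then have FT: "F -` interior T = interior ref_cube"
    using interior_vimage_aff_map[OF det, of c T] by (simp add: F_def)
  then have F'Q: "F' -` interior ref_cube = interior T"
    unfolding FT[symmetric] by (auto simp: inverse)
  note est = sobolev_aff_map[OF p det open_interior w, of c, folded F_def, unfolded FT]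
  have roundtrip: "(\<lambda>y. w (F (F' y))) = w"
    by (simp add: inverse)
  have "\<bar>det (matrix_inv A)\<bar> powr (- enn2real (1 / p)) = \<bar>det A\<bar> powr enn2real (1 / p)"
    using det by (simp add: det_matrix_inv powr_minus abs_inverse inverse_powr)
  \<comment> \<open>For the second estimate the input is the composition, a Sobolev function by
    \<open>est(1)\<close>, and composing it with the inverse map returns w itself.\<close>
  moreover note sobolev_aff_map(2)[OF p det_matrix_inv_nz[OF det] open_interior est(1),
      of "- (matrix_inv A *v c)", folded F'_def, unfolded F'Q roundtrip]
  ultimately show "let w' = w \<circ> aff_map (J T) (b T) in
          w' \<in> sobolev_space l p (interior ref_cube) \<and>
          sobolev_seminorm l p (interior ref_cube) w'
            \<le> chain_const TYPE('n) l * spectral_norm (J T) ^ l * \<bar>det (J T)\<bar> powr (- enn2real (1 / p))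
                * sobolev_seminorm l p (interior T) w \<and>
          sobolev_seminorm l p (interior T) w
            \<le> chain_const TYPE('n) l * spectral_norm (matrix_inv (J T)) ^ l * \<bar>det (J T)\<bar> powr enn2real (1 / p)
                * sobolev_seminorm l p (interior ref_cube) w'"
    using est unfolding Let_def o_def F_def A_def c_def by simp
qed

end
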